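(* Let $Q$ be a Dynkin quiver of type $\mathbb A_n$ and let $\mathcal P=\mathcal P_{Q}$ be the poset of type $\mathbb A$ associated to $Q^{\emptyset}=Q$ (that is, with empty alien set $F=\emptyset$). Let $\mathcal A=\mathcal A(\mathbf x,Q)$ be the cluster algebra with initial seed $(\mathbf x,Q)$ and let $\mathcal A(\mathcal P)$ be the subalgebra of $\mathcal A$ associated to $\mathcal P$, i.e. the subalgebra generated by the initial cluster variables in $\mathbf x$ together with the cluster variables $x_\gamma$ for all sp-diagonals $\gamma$. Then $\mathcal A(\mathcal P)=\mathcal A$.
   Context: A Dynkin quiver of type $\mathbb A_n$ is any orientation of the path graph with $n$ vertices. $\mathcal P_Q$ is the vertex set of $Q$ ordered by $x\preceq y$ iff there is a path from $x$ to $y$ in $Q$. $\mathcal A(\mathbf x,Q)$ is the (coefficient-free) Fomin–Zelevinsky cluster algebra with initial cluster $\mathbf x=\{x_1,\dots,x_n\}$ and initial quiver $Q$, i.e. the subalgebra of $\mathbb Q(x_1,\dots,x_n)$ generated by all cluster variables. Let $T=\{\tau_1,\dots,\tau_n\}$ be a triangulation (maximal set of non-crossing diagonals) of the regular $(n+3)$-gon with $Q_T=Q$, where $Q_T$ has vertices $1,\dots,n$ and an arrow $x\to y$ iff $\tau_x,\tau_y$ are sides of a common triangle of $T$ in which $\tau_y$ comes right after $\tau_x$ when following the boundary of the triangle counter-clockwise. The cluster variables of $\mathcal A$ are in bijection $\gamma\mapsto x_\gamma$ with the diagonals of the polygon, with $x_{\tau_i}=x_i$; exchange relations are the Ptolemy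 relations in quadrilaterals, boundary edges having value $1$. A fan in $T$ is a maximal subset $\Sigma_v\subseteq T$ of at least two diagonals such that all the diagonals in $\Sigma_v$ share the polygon vertex $v$. The peak-diagonal of a fan is its maximal element for the order $\tau_x<\tau_y$ iff there is a path from $x$ to $y$ in $Q$. Since $F=\emptyset$, an sp-diagonal is a diagonal $\gamma\notin T$ such that whenever $\gamma$ crosses $\tau\in T$, $\gamma$ crosses the peak-diagonal of a fan in $T$ containing $\tau$.
   Formalization: The formal theorem assumes n ≥ 2: for n = 1 there are no fans (a fan needs at least two diagonals), hence no sp-diagonals, so A(P) = Q[x_1] differs from A = Q[x_1, 2/x_1] and the claim fails. *)

theory Defs
  imports Complex_Main "HOL-Library.Poly_Mapping" "HOL-Computational_Algebra.Fraction_Field"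
begin

section \<open>The ambient field and its subalgebras\<close>

text \<open>
  \<open>nat \<Rightarrow>\<^sub>0 nat\<close> is the type of monomials in the indeterminates $x_0, x_1, x_2, \ldots$, so
  \<open>ratfun\<close> is the field of rational functions over the rationals in countably many indeterminates.
  For every $n$ it contains the field $\mathbb{Q}(x_1,\ldots,x_n)$, which is the only part that
  the constructions below for a given $n$ ever reach.
\<close>

type_synonym ratfun = "((nat \<Rightarrow>\<^sub>0 nat) \<Rightarrow>\<^sub>0 rat) fract"

definition scalar :: "rat \<Rightarrow> ratfun"
  where "scalar c = Fract (Poly_Mapping.single 0 c) 1"

definition var :: "nat \<Rightarrow> ratfun"
  where "var i = Fract (Poly_Mapping.single (Poly_Mapping.single i 1) 1) 1"

definition is_subalgebra :: "ratfun set \<Rightarrow> bool"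
  where "is_subalgebra A \<longleftrightarrow>
    range scalar \<subseteq> A \<and> (\<forall>a\<in>A. \<forall>b\<in>A. a + b \<in> A) \<and> (\<forall>a\<in>A. \<forall>b\<in>A. a * b \<in> A)"

definition generated_subalgebra :: "ratfun set \<Rightarrow> ratfun set"
  where "generated_subalgebra S = is_subalgebra hull S"


section \<open>Quivers of type A and their posets\<close>

text \<open>
  A quiver without loops, 2-cycles and multiple arrows is the set of its arrows;
  its vertices are $1,\ldots,n$.
\<close>

definition type_A_quiver :: "nat \<Rightarrow> nat rel \<Rightarrow> bool"
  where "type_A_quiver n Q \<longleftrightarrow>
    Q \<subseteq> (\<Union>i\<in>{1..<n}. {(i, Suc i), (Suc i, i)}) \<and>
    (\<forall>i\<in>{1..<n}. ((i, Suc i) \<in> Q) \<noteq> ((Suc i, i) \<in> Q))"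

definition quiver_poset :: "nat \<Rightarrow> nat rel \<Rightarrow> nat rel"
  where "quiver_poset n Q = {(x, y). x \<in> {1..n} \<and> y \<in> {1..n} \<and> (x, y) \<in> Q\<^sup>*}"


section \<open>The cluster algebra of a quiver\<close>

text \<open>
  Seeds are pairs of an exchange matrix and a cluster, both indexed by $1,\ldots,n$; the entry
  \<open>B i j\<close> is the number of arrows from \<open>i\<close> to \<open>j\<close> minus the number of arrows from \<open>j\<close> to \<open>i\<close>.
\<close>

type_synonym seed = "(nat \<Rightarrow> nat \<Rightarrow> int) \<times> (nat \<Rightarrow> ratfun)"

definition quiver_matrix :: "nat rel \<Rightarrow> nat \<Rightarrow> nat \<Rightarrow> int"
  where "quiver_matrix Q i j = of_bool ((i, j) \<in> Q) - of_bool ((j, i) \<in> Q)"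

definition mutate_matrix :: "nat \<Rightarrow> (nat \<Rightarrow> nat \<Rightarrow> int) \<Rightarrow> nat \<Rightarrow> nat \<Rightarrow> int"
  where "mutate_matrix k B i j =
    (if i = k \<or> j = k then - B i j
     else B i j + max (B i k) 0 * max (B k j) 0 - max (- B i k) 0 * max (- B k j) 0)"

definition mutate_cluster ::
    "nat \<Rightarrow> nat \<Rightarrow> (nat \<Rightarrow> nat \<Rightarrow> int) \<Rightarrow> (nat \<Rightarrow> ratfun) \<Rightarrow> nat \<Rightarrow> ratfun"
  where "mutate_cluster n k B u =
    u(k := ((\<Prod>i=1..n. u i ^ nat (B i k)) + (\<Prod>i=1..n. u i ^ nat (- B i k))) / u k)"

inductive_set seeds :: "nat \<Rightarrow> nat rel \<Rightarrow> seed set"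
  for n :: nat and Q :: "nat rel"
  where
    initial: "(quiver_matrix Q, var) \<in> seeds n Q"
  | mutation: "(B, u) \<in> seeds n Q \<Longrightarrow> k \<in> {1..n} \<Longrightarrow>
      (mutate_matrix k B, mutate_cluster n k B u) \<in> seeds n Q"

definition cluster_variables :: "nat \<Rightarrow> nat rel \<Rightarrow> ratfun set"
  where "cluster_variables n Q = {u i |B u i. (B, u) \<in> seeds n Q \<and> i \<in> {1..n}}"

definition cluster_algebra :: "nat \<Rightarrow> nat rel \<Rightarrow> ratfun set"
  where "cluster_algebra n Q = generated_subalgebra (cluster_variables n Q)"


section \<open>Triangulations of polygons\<close>

text \<open>
  The vertices of the regular \<open>N\<close>-gon are $0,\ldots,N-1$, numbered counter-clockwise; edges and
  diagonals are the two-element sets of their endpoints.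
\<close>

definition boundary_edges :: "nat \<Rightarrow> nat set set"
  where "boundary_edges N = (\<lambda>i. {i, Suc i mod N}) ` {..<N}"

definition diagonals :: "nat \<Rightarrow> nat set set"
  where "diagonals N = {{a, b} |a b. a < b \<and> b < N} - boundary_edges N"

definition crosses :: "nat set \<Rightarrow> nat set \<Rightarrow> bool"
  where "crosses \<gamma> \<delta> \<longleftrightarrow> (\<exists>a b c d. a < b \<and> b < c \<and> c < d \<and>
    (\<gamma> = {a, c} \<and> \<delta> = {b, d} \<or> \<gamma> = {b, d} \<and> \<delta> = {a, c}))"

definition is_triangulation :: "nat \<Rightarrow> nat set set \<Rightarrow> bool"
  where "is_triangulation N T \<longleftrightarrow> T \<subseteq> diagonals N \<and>
    (\<forall>\<gamma>\<in>T. \<forall>\<delta>\<in>T. \<not> crosses \<gamma> \<delta>) \<and>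
    (\<forall>\<gamma>\<in>diagonals N - T. \<exists>\<delta>\<in>T. crosses \<gamma> \<delta>)"

text \<open>
  In a triangle with vertices \<open>a < b < c\<close> the counter-clockwise boundary runs through the sides
  \<open>{a, b}\<close>, \<open>{b, c}\<close>, \<open>{c, a}\<close> in this cyclic order.
\<close>

definition ccw_sides :: "nat \<Rightarrow> nat \<Rightarrow> nat \<Rightarrow> (nat set \<times> nat set) set"
  where "ccw_sides a b c = {({a, b}, {b, c}), ({b, c}, {c, a}), ({c, a}, {a, b})}"

text \<open>The function \<open>\<tau>\<close> labels the diagonals of a triangulation of the \<open>(n + 3)\<close>-gon by $1,\ldots,n$.\<close>

definition triangulation_quiver :: "nat \<Rightarrow> (nat \<Rightarrow> nat set) \<Rightarrow> nat rel"
  where "triangulation_quiver n \<tau> = {(x, y). x \<in> {1..n} \<and> y \<in> {1..n} \<and>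
    (\<exists>a b c. a < b \<and> b < c \<and> c < n + 3 \<and>
      {{a, b}, {b, c}, {c, a}} \<subseteq> \<tau> ` {1..n} \<union> boundary_edges (n + 3) \<and>
      (\<tau> x, \<tau> y) \<in> ccw_sides a b c)}"

text \<open>
  The bijection $\gamma \mapsto x_\gamma$ from the diagonals to the cluster variables: the Ptolemy
  relations, applied in turn to the diagonals crossing fewer and fewer members of the
  triangulation, determine its values from those on the triangulation and on the boundary edges.
  On sets that are neither diagonals nor boundary edges \<open>X\<close> is arbitrary.
\<close>

definition ptolemy_function :: "nat \<Rightarrow> (nat \<Rightarrow> nat set) \<Rightarrow> (nat set \<Rightarrow> ratfun) \<Rightarrow> bool"
  where "ptolemy_function n \<tau> X \<longleftrightarrow>
    (\<forall>i\<in>{1..n}. X (\<tau> i) = var i) \<and>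
    (\<forall>e\<in>boundary_edges (n + 3). X e = 1) \<and>
    (\<forall>a b c d. a < b \<and> b < c \<and> c < d \<and> d < n + 3 \<longrightarrow>
      X {a, c} * X {b, d} = X {a, b} * X {c, d} + X {b, c} * X {a, d})"

definition diagonal_variable :: "nat \<Rightarrow> (nat \<Rightarrow> nat set) \<Rightarrow> nat set \<Rightarrow> ratfun"
  where "diagonal_variable n \<tau> \<gamma> = (THE y. \<exists>X. ptolemy_function n \<tau> X \<and> X \<gamma> = y)"


section \<open>Fans, sp-diagonals and the subalgebra of a poset\<close>

definition is_fan :: "nat set set \<Rightarrow> nat set set \<Rightarrow> bool"
  where "is_fan T \<Sigma> \<longleftrightarrow> (\<exists>v. \<Sigma> = {\<delta> \<in> T. v \<in> \<delta>}) \<and> 2 \<le> card \<Sigma>"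

text \<open>
  \<open>P\<close> is the partial order on the labels $1,\ldots,n$. The labels of a fan form a chain when \<open>P\<close> is
  the poset of the quiver of the triangulation, so the peak of a fan is unique.
\<close>

definition is_peak :: "nat \<Rightarrow> (nat \<Rightarrow> nat set) \<Rightarrow> nat rel \<Rightarrow> nat set set \<Rightarrow> nat set \<Rightarrow> bool"
  where "is_peak n \<tau> P \<Sigma> \<delta> \<longleftrightarrow> (\<exists>x\<in>{1..n}. \<delta> = \<tau> x \<and> \<tau> x \<in> \<Sigma> \<and>
    (\<forall>y\<in>{1..n}. \<tau> y \<in> \<Sigma> \<and> (x, y) \<in> P \<longrightarrow> y = x))"

definition sp_diagonals :: "nat \<Rightarrow> (nat \<Rightarrow> nat set) \<Rightarrow> nat rel \<Rightarrow> nat set set"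
  where "sp_diagonals n \<tau> P = {\<gamma> \<in> diagonals (n + 3) - \<tau> ` {1..n}.
    \<forall>\<delta>\<in>\<tau> ` {1..n}. crosses \<gamma> \<delta> \<longrightarrow>
      (\<exists>\<Sigma> \<pi>. is_fan (\<tau> ` {1..n}) \<Sigma> \<and> \<delta> \<in> \<Sigma> \<and> is_peak n \<tau> P \<Sigma> \<pi> \<and> crosses \<gamma> \<pi>)}"

definition poset_subalgebra :: "nat \<Rightarrow> (nat \<Rightarrow> nat set) \<Rightarrow> nat rel \<Rightarrow> ratfun set"
  where "poset_subalgebra n \<tau> P =
    generated_subalgebra (var ` {1..n} \<union> diagonal_variable n \<tau> ` sp_diagonals n \<tau> P)"

end

(* Seeds correspond to labelled triangulations, mutation being the flip of a diagonal {a, c} to the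
   other diagonal {b, d} of its quadrilateral. Cluster variables are quotients of polynomials with
   nonnegative coefficients, hence nonzero, so the Ptolemy relation identifies the mutated variable
   with the value at the flipped diagonal. Every diagonal is reached by flips, so each x_gamma is a
   cluster variable and two solutions of the Ptolemy relations agree.

   For the converse inclusion, x_{a,b} = x_{a,b-1} x_{b-2,b} - x_{a,b-2} reduces everything to the
   diagonals {k - 1, k + 1}. These are polynomials in initial variables and the values at sp-diagonals
   {v + 1, w} with {v, w} in the triangulation or on the boundary: such a diagonal crosses only
   members of the fan at v, among them the first one after v + 1, which is the peak. *)

theory Submission
  imports Defs
begin

section \<open>Cyclic order and crossings\<close>

text \<open>For \<open>n = 1\<close> a square has no fan, hence no sp-diagonal, and the algebra
  generated by \<open>x_1\<close> alone misses the cluster variable \<open>2 / x_1\<close>; this is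
  why \<open>2 \<le> n\<close> is assumed. The obstacle is a vertex \<open>k\<close> with a single
  spoke \<open>{v, k}\<close>: this spoke is no fan at \<open>k\<close>, and the peak of the fan at
  \<open>v\<close> need not be crossed by the diagonal from \<open>k - 1\<close> to
  \<open>k + 1\<close>. The successor of \<open>v\<close> is the right fourth vertex because arrows
  between neighbouring spokes at \<open>v\<close> point towards the spoke that comes earlier
  counter-clockwise after \<open>v\<close>. Boundary edges have value 1, so both Ptolemy relations
  that drive the generation are solved for the wanted value without division, which keeps the
  argument inside a subalgebra. As \<open>diagonal_variable\<close> is a definite description, a
  solution of the Ptolemy relations must also be exhibited; it comes from determinants of plane
  vectors.\<close>

definition cyc :: "nat \<Rightarrow> nat \<Rightarrow> nat \<Rightarrow> bool"
  where "cyc a b c \<longleftrightarrow> a < b \<and> b < c \<or> b < c \<and> c < a \<or> c < a \<and> a < b"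

lemma cyc_rotate: "cyc a b c \<Longrightarrow> cyc b c a"
  by (auto simp: cyc_def)

lemma cyc_asym: "cyc a b c \<Longrightarrow> \<not> cyc c b a"
  by (auto simp: cyc_def)

lemma cyc_distinct: "cyc a b c \<Longrightarrow> a \<noteq> b \<and> b \<noteq> c \<and> a \<noteq> c"
  by (auto simp: cyc_def)

lemma cyc_split: "cyc a x c \<Longrightarrow> cyc a b c \<Longrightarrow> x = b \<or> cyc a x b \<or> cyc b x c"
  unfolding cyc_def by arith

lemma cyc_trans: "cyc a b c \<Longrightarrow> cyc a c d \<Longrightarrow> cyc a b d"
  unfolding cyc_def by arith

lemma cyc_trans': "cyc a b c \<Longrightarrow> cyc a c d \<Longrightarrow> cyc b c d"
  unfolding cyc_def by arith

text \<open>In \<open>crosses\<close> the four points are listed by size, which singles out vertex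
  0. The cyclic form is invariant under rotation of the polygon, so later arguments need no case
  distinction on where the numbering starts.\<close>

lemma crosses_iff_cyc:
  "crosses \<gamma> \<delta> \<longleftrightarrow> (\<exists>a b c d. \<gamma> = {a, c} \<and> \<delta> = {b, d} \<and> cyc a b c \<and> cyc c d a)"
proof
  assume "crosses \<gamma> \<delta>"
  then obtain a b c d where "a < b" "b < c" "c < d"
    and "\<gamma> = {a, c} \<and> \<delta> = {b, d} \<or> \<gamma> = {b, d} \<and> \<delta> = {a, c}"
    unfolding crosses_def by blast
  moreover from this have "cyc a b c" "cyc c d a" "cyc b c d" "cyc d a b"
    by (auto simp: cyc_def)
  ultimately show "\<exists>a b c d. \<gamma> = {a, c} \<and> \<delta> = {b, d} \<and> cyc a b c \<and> cyc c d a"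
    by blast
next
  assume "\<exists>a b c d. \<gamma> = {a, c} \<and> \<delta> = {b, d} \<and> cyc a b c \<and> cyc c d a"
  then obtain a b c d where eq: "\<gamma> = {a, c}" "\<delta> = {b, d}" and "cyc a b c" "cyc c d a"
    by blast
  \<comment> \<open>The cases differ in which of the four points is the least.\<close>
  then consider "a < b" "b < c" "c < d" | "b < c" "c < d" "d < a" | "c < d" "d < a" "a < b"
    | "d < a" "a < b" "b < c"
    by (auto simp: cyc_def)
  then show "crosses \<gamma> \<delta>"
    unfolding crosses_def eq
  proof cases
    case 1
    then show "\<exists>p q r s. p < q \<and> q < r \<and> r < s \<and>
      ({a, c} = {p, r} \<and> {b, d} = {q, s} \<or> {a, c} = {q, s} \<and> {b, d} = {p, r})"
      by blast
  next
    case 2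
    then show "\<exists>p q r s. p < q \<and> q < r \<and> r < s \<and>
      ({a, c} = {p, r} \<and> {b, d} = {q, s} \<or> {a, c} = {q, s} \<and> {b, d} = {p, r})"
      by (intro exI[of _ b] exI[of _ c] exI[of _ d] exI[of _ a]) (simp add: insert_commute)
  next
    case 3
    then show "\<exists>p q r s. p < q \<and> q < r \<and> r < s \<and>
      ({a, c} = {p, r} \<and> {b, d} = {q, s} \<or> {a, c} = {q, s} \<and> {b, d} = {p, r})"
      by (intro exI[of _ c] exI[of _ d] exI[of _ a] exI[of _ b]) (simp add: insert_commute)
  next
    case 4
    then show "\<exists>p q r s. p < q \<and> q < r \<and> r < s \<and>
      ({a, c} = {p, r} \<and> {b, d} = {q, s} \<or> {a, c} = {q, s} \<and> {b, d} = {p, r})"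
      by (intro exI[of _ d] exI[of _ a] exI[of _ b] exI[of _ c]) (simp add: insert_commute)
  qed
qed

lemma crossesI: "cyc a b c \<Longrightarrow> cyc c d a \<Longrightarrow> crosses {a, c} {b, d}"
  unfolding crosses_iff_cyc by blast

lemma crosses_sym: "crosses \<gamma> \<delta> \<Longrightarrow> crosses \<delta> \<gamma>"
  unfolding crosses_def by blast

lemma crosses_pair_iff:
  "crosses {p, q} \<delta> \<longleftrightarrow> (\<exists>x y. \<delta> = {x, y} \<and> cyc p x q \<and> cyc q y p)"
proof
  assume "crosses {p, q} \<delta>"
  then obtain a b c d where "{p, q} = {a, c}" "\<delta> = {b, d}" "cyc a b c" "cyc c d a"
    unfolding crosses_iff_cyc by blast
  moreover from this have "p = a \<and> q = c \<or> p = c \<and> q = a"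
    by (auto simp: doubleton_eq_iff)
  ultimately show "\<exists>x y. \<delta> = {x, y} \<and> cyc p x q \<and> cyc q y p"
    by (metis insert_commute)
qed (auto intro: crossesI)

section \<open>Boundary edges of the polygon\<close>

lemma boundary_not_between:
  assumes "v < N" "z < N"
  shows "\<not> cyc v z (Suc v mod N)"
  using assms by (cases "Suc v = N") (auto simp: cyc_def)

lemma cyc_next:
  assumes "a < N" "c < N" "a \<noteq> c" "{a, c} \<notin> boundary_edges N"
  shows "cyc a (Suc a mod N) c"
proof -
  have "c \<noteq> Suc a mod N"
    using assms(1,4) unfolding boundary_edges_def by blast
  then show ?thesis
    using assms(1-3) by (cases "Suc a = N") (auto simp: cyc_def)
qed

lemma boundary_edge_cases:
  assumes "{a, b} \<in> boundary_edges N"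
  shows "a < N \<and> b = Suc a mod N \<or> b < N \<and> a = Suc b mod N"
  using assms unfolding boundary_edges_def by (auto simp: doubleton_eq_iff)

lemma boundary_edge_mem: "v < N \<Longrightarrow> {v, Suc v mod N} \<in> boundary_edges N"
  unfolding boundary_edges_def by blast

lemma pair_mem:
  assumes "a \<noteq> b" "a < N" "b < N"
  shows "{a, b} \<in> {{a, b} |a b. a < b \<and> b < (N :: nat)}"
proof (cases "a < b")
  case True
  then show ?thesis using assms by blast
next
  case False
  then have "{a, b} = {b, a}" "b < a" using assms by auto
  then show ?thesis using assms by blast
qed

lemma boundary_edge_pair:
  assumes "\<delta> \<in> boundary_edges N" "2 \<le> N"
  shows "\<delta> \<in> {{a, b} |a b. a < b \<and> b < N}"
proof -
  obtain v where v: "v < N" "\<delta> = {v, Suc v mod N}"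
    using assms(1) unfolding boundary_edges_def by blast
  show ?thesis
  proof (cases "Suc v = N")
    case True
    then have "\<delta> = {0, v}" "0 < v" using v assms(2) by auto
    then show ?thesis using v by blast
  next
    case False
    then have "\<delta> = {v, Suc v}" "Suc v < N" using v by auto
    then show ?thesis by blast
  qed
qed

lemma boundary_not_crossed:
  assumes "\<delta> \<in> boundary_edges N" "\<gamma> \<subseteq> {..<N}"
  shows "\<not> crosses \<delta> \<gamma>"
proof
  assume "crosses \<delta> \<gamma>"
  moreover obtain v where v: "v < N" "\<delta> = {v, Suc v mod N}"
    using assms(1) unfolding boundary_edges_def by blast
  ultimately obtain x y where "\<gamma> = {x, y}" "cyc v x (Suc v mod N)"
    by (auto simp: crosses_pair_iff)
  then show False
    using boundary_not_between assms(2) v(1) by auto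
qed

text \<open>Used to pick the last spoke at \<open>a\<close> before \<open>c\<close>; beyond it no
  vertex is joined to \<open>a\<close>, which forces the third side of a triangle.\<close>

lemma farthest_vertex:
  assumes "x0 < N" "cyc a x0 c" "P x0"
  obtains b where "b < N" "cyc a b c" "P b" "\<And>x. x < N \<Longrightarrow> cyc b x c \<Longrightarrow> \<not> P x"
proof -
  \<comment> \<open>The polygon is cut open at \<open>a\<close>: vertices up to \<open>a\<close> are
    moved behind the others, so that cyclic order from \<open>a\<close> becomes the order of
    \<open>key\<close>.\<close>
  define key where "key x = (if a < x then x else x + N)" for x
  define S where "S = {x. x < N \<and> cyc a x c \<and> P x}"
  have "\<forall>x. x \<in> S \<longrightarrow> key x < 2 * N"
    by (auto simp: S_def key_def)
  moreover have "x0 \<in> S"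
    using assms by (simp add: S_def)
  ultimately obtain b where b: "b \<in> S" and max: "\<And>x. x \<in> S \<Longrightarrow> key x \<le> key b"
    using ex_has_greatest_nat[of "\<lambda>x. x \<in> S" x0 key "2 * N"] by blast
  show thesis
  proof
    fix x assume x: "x < N" "cyc b x c"
    then have abx: "cyc a b x" and "cyc a x c"
      using b cyc_rotate[of b x c] cyc_rotate[of x c b] cyc_rotate
        cyc_trans'[of c a b x] cyc_trans[of c a b x] unfolding S_def by blast+
    moreover from abx have "key b < key x"
      using b x(1) unfolding S_def key_def cyc_def by auto
    ultimately have "cyc a x c" "key b < key x" by auto
    then show "\<not> P x"
      using max[of x] x by (auto simp: S_def)
  qed (use b in \<open>auto simp: S_def\<close>)
qed

lemma nearest_vertex:
  assumes "x0 < N" "x0 \<noteq> a" "P x0"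
  obtains b where "b < N" "b \<noteq> a" "P b" "\<And>x. x < N \<Longrightarrow> cyc a x b \<Longrightarrow> \<not> P x"
proof -
  define key where "key x = (if a < x then x else x + N)" for x
  define S where "S = {x. x < N \<and> x \<noteq> a \<and> P x}"
  obtain b where b: "b \<in> S" and min: "\<And>x. x \<in> S \<Longrightarrow> key b \<le> key x"
    using ex_has_least_nat[of "\<lambda>x. x \<in> S" x0 key] assms by (auto simp: S_def)
  show thesis
  proof
    fix x assume x: "x < N" "cyc a x b"
    then have "x \<noteq> a" "key x < key b"
      using b unfolding S_def key_def cyc_def by auto
    then show "\<not> P x"
      using min[of x] x by (auto simp: S_def)
  qed (use b in \<open>auto simp: S_def\<close>)
qed


section \<open>Triangulations as edge sets\<close>

text \<open>Maximality is replaced by \<open>apex\<close>: an edge with a vertex strictly inside the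
  arc from \<open>a\<close> to \<open>c\<close> is a side of a triangle on that side. This condition
  is local, so it survives a flip by inspecting the triangles that contain the removed
  diagonal.\<close>

locale triangulated =
  fixes N :: nat and E :: "nat set set"
  assumes size: "3 \<le> N"
    and boundary: "boundary_edges N \<subseteq> E"
    and pairs: "E \<subseteq> {{a, b} |a b. a < b \<and> b < N}"
    and noncrossing: "\<gamma> \<in> E \<Longrightarrow> \<delta> \<in> E \<Longrightarrow> \<not> crosses \<gamma> \<delta>"
    and apex: "{a, c} \<in> E \<Longrightarrow> z < N \<Longrightarrow> cyc a z c \<Longrightarrow>
      \<exists>b<N. cyc a b c \<and> {a, b} \<in> E \<and> {b, c} \<in> E"
begin

lemma edgeD:
  assumes "{a, b} \<in> E"
  shows "a < N" "b < N" "a \<noteq> b"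
proof -
  obtain x y where "{a, b} = {x, y}" "x < y" "y < N"
    using assms pairs by blast
  then show "a < N" "b < N" "a \<noteq> b"
    by (auto simp: doubleton_eq_iff)
qed

lemma next_edge: "v < N \<Longrightarrow> {v, Suc v mod N} \<in> E"
  using boundary boundary_edge_mem by blast

lemma not_cross: "{a, c} \<in> E \<Longrightarrow> {b, d} \<in> E \<Longrightarrow> cyc a b c \<Longrightarrow> \<not> cyc c d a"
  using noncrossing crossesI by blast

text \<open>The rotation-invariant form of \<open>ccw_sides\<close>. Boundary edges take part too,
  so that the four sides of a quadrilateral are treated alike; restricting to labels gives back the
  quiver.\<close>

definition arrow :: "nat set \<Rightarrow> nat set \<Rightarrow> bool"
  where "arrow \<gamma> \<delta> \<longleftrightarrow> (\<exists>x y z. cyc x y z \<and> {x, y} \<in> E \<and> {y, z} \<in> E \<and> {z, x} \<in> E \<and>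
    \<gamma> = {x, y} \<and> \<delta> = {y, z})"

lemma arrowI:
  "cyc x y z \<Longrightarrow> {x, y} \<in> E \<Longrightarrow> {y, z} \<in> E \<Longrightarrow> {z, x} \<in> E \<Longrightarrow> arrow {x, y} {y, z}"
  unfolding arrow_def by blast

text \<open>Two sides of a triangle determine its vertices, so arrows in both directions would
  orient one triangle in both ways. Hence the quiver has no 2-cycles.\<close>

lemma arrow_asym: "arrow \<gamma> \<delta> \<Longrightarrow> \<not> arrow \<delta> \<gamma>"
  unfolding arrow_def by (auto simp: doubleton_eq_iff dest: cyc_asym cyc_distinct)

lemma arrow_irrefl: "\<not> arrow \<gamma> \<gamma>"
  using arrow_asym by blast

end

locale quadrilateral = triangulated +
  fixes a b c d :: nat
  assumes cyc_abc: "cyc a b c" and cyc_cda: "cyc c d a"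
    and ab: "{a, b} \<in> E" and bc: "{b, c} \<in> E" and cd: "{c, d} \<in> E" and da: "{d, a} \<in> E"
    and ac: "{a, c} \<in> E"
begin

lemma cyc_more: "cyc b c d" "cyc d a b" "cyc b d a" "cyc b c a" "cyc c a b" "cyc d a c" "cyc a c d"
    "cyc c d b" "cyc d b c" "cyc a b d"
  using cyc_trans'[OF cyc_abc cyc_rotate[OF cyc_rotate[OF cyc_cda]]]
    cyc_trans[OF cyc_abc cyc_rotate[OF cyc_rotate[OF cyc_cda]]] cyc_abc cyc_cda
  by (meson cyc_rotate)+

lemma quad_distinct: "distinct [a, b, c, d]"
  using cyc_distinct[OF cyc_abc] cyc_distinct[OF cyc_cda] cyc_distinct[OF cyc_more(1)] by simp

lemma sides_distinct: "distinct [{a, b}, {b, c}, {c, d}, {d, a}, {a, c}, {b, d}]"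
  using quad_distinct by (auto simp: doubleton_eq_iff)

lemma bd_notin: "{b, d} \<notin> E"
  using not_cross[OF ac _ cyc_abc] cyc_cda by blast

text \<open>An apex before \<open>b\<close> would be joined to \<open>c\<close> across
  \<open>{a, b}\<close>; one after \<open>b\<close> would be joined to \<open>a\<close> across
  \<open>{b, c}\<close>.\<close>

lemma apex_unique:
  assumes "{a, x} \<in> E" "{x, c} \<in> E" "cyc a x c"
  shows "x = b"
proof (rule ccontr)
  assume "x \<noteq> b"
  then consider "cyc a x b" | "cyc b x c"
    using cyc_split[OF assms(3) cyc_abc] by blast
  then show False
  proof cases
    case 1
    then show False
      using not_cross[OF ab assms(2)] cyc_more cyc_rotate cyc_trans'[OF _ cyc_abc] by blast
  next
    case 2
    then show False
      using not_cross[OF bc, of x a] assms(1) cyc_more by (simp add: insert_commute)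
  qed
qed

section \<open>Arrows around a quadrilateral\<close>

lemma rotate_half: "quadrilateral N E c d a b"
  using cyc_abc cyc_cda ab bc cd da ac by unfold_locales (auto simp: insert_commute)

lemma arrows_at_diagonal:
  "arrow {b, c} {a, c}" "arrow {d, a} {a, c}" "arrow {a, c} {a, b}" "arrow {a, c} {c, d}"
  using arrowI[of b c a] arrowI[of d a c] arrowI[of c a b] arrowI[of a c d]
    ab bc cd da ac cyc_more
  by (simp_all add: insert_commute)

text \<open>The apex on each side is unique, so \<open>{a, c}\<close> lies in exactly two triangles,
  and each of them contributes one incoming arrow.\<close>

lemma arrow_to_diagonal: "arrow \<gamma> {a, c} \<longleftrightarrow> \<gamma> = {b, c} \<or> \<gamma> = {d, a}"
proof
  assume "arrow \<gamma> {a, c}"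
  then obtain x y z where xyz: "cyc x y z" "{x, y} \<in> E" "{y, z} \<in> E" "{z, x} \<in> E"
    "\<gamma> = {x, y}" "{a, c} = {y, z}"
    unfolding arrow_def by blast
  then consider "y = a" "z = c" | "y = c" "z = a"
    by (auto simp: doubleton_eq_iff)
  then show "\<gamma> = {b, c} \<or> \<gamma> = {d, a}"
  proof cases
    case 1
    then have "x = d"
      using quadrilateral.apex_unique[OF rotate_half, of x] xyz(2-4) 1 cyc_rotate[OF cyc_rotate[OF xyz(1)]] by blast
    then show ?thesis using 1 xyz(5) by simp
  next
    case 2
    then have "x = b"
      using apex_unique[of x] xyz(2-4) 2 cyc_rotate[OF cyc_rotate[OF xyz(1)]] by blast
    then show ?thesis using 2 xyz(5) by simp
  qed
qed (use arrows_at_diagonal in blast)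

lemma arrow_from_diagonal: "arrow {a, c} \<gamma> \<longleftrightarrow> \<gamma> = {a, b} \<or> \<gamma> = {c, d}"
proof
  assume "arrow {a, c} \<gamma>"
  then obtain x y z where xyz: "cyc x y z" "{x, y} \<in> E" "{y, z} \<in> E" "{z, x} \<in> E"
    "\<gamma> = {y, z}" "{a, c} = {x, y}"
    unfolding arrow_def by blast
  then consider "x = a" "y = c" | "x = c" "y = a"
    by (auto simp: doubleton_eq_iff)
  then show "\<gamma> = {a, b} \<or> \<gamma> = {c, d}"
  proof cases
    case 1
    then have "z = d"
      using quadrilateral.apex_unique[OF rotate_half, of z] xyz(2-4) 1 cyc_rotate[OF xyz(1)] by blast
    then show ?thesis using 1 xyz(5) by simp
  next
    case 2
    then have "z = b"
      using apex_unique[of z] xyz(2-4) 2 cyc_rotate[OF xyz(1)] by blast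
    then show ?thesis using 2 xyz(5) by simp
  qed
qed (use arrows_at_diagonal in blast)

lemma arrow_sides: "arrow {a, b} {b, c}" "arrow {c, d} {d, a}"
  using arrowI[of a b c] arrowI[of c d a] ab bc cd da ac cyc_abc cyc_cda
  by (simp_all add: insert_commute)

text \<open>The third side of such a triangle would be \<open>{b, d}\<close>, which crosses
  \<open>{a, c}\<close>.\<close>

lemma no_arrow_sides: "\<not> arrow {d, a} {a, b}" "\<not> arrow {b, c} {c, d}"
  unfolding arrow_def using bd_notin quad_distinct by (auto simp: doubleton_eq_iff insert_commute)

section \<open>The flip of a diagonal\<close>

definition flip :: "nat set set"
  where "flip = insert {b, d} (E - {{a, c}})"

text \<open>The end of \<open>\<gamma>\<close> on the arc from \<open>b\<close> to \<open>d\<close>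
  must be \<open>c\<close>, since otherwise \<open>\<gamma>\<close> crosses \<open>{b, c}\<close> or
  \<open>{c, d}\<close>. In the same way the other end must be \<open>a\<close>.\<close>

lemma flip_noncrossing:
  assumes "\<gamma> \<in> E" "crosses {b, d} \<gamma>"
  shows "\<gamma> = {a, c}"
proof -
  obtain x y where xy: "\<gamma> = {x, y}" "cyc b x d" "cyc d y b"
    using assms(2) by (auto simp: crosses_pair_iff)
  have E: "{x, y} \<in> E" "{y, x} \<in> E" using assms(1) xy by (auto simp: insert_commute)
  have "cyc c y b" "cyc d y c"
    using cyc_trans[of b c d y] cyc_trans'[of b c d y] xy(3) cyc_more(1) cyc_rotate by blast+
  then have "\<not> cyc b x c" "\<not> cyc c x d"
    using not_cross[OF bc E(1)] not_cross[OF cd E(1)] by blast+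
  then have "x = c"
    using cyc_split[OF xy(2) cyc_more(1)] by blast
  then have "\<not> cyc d y a" "\<not> cyc a y b"
    using not_cross[OF da E(2)] not_cross[OF ab E(2)] cyc_more by blast+
  then have "y = a"
    using cyc_split[OF xy(3) cyc_more(2)] by blast
  with \<open>x = c\<close> show ?thesis using xy by (simp add: insert_commute)
qed

lemma flip_sides: "{a, b} \<in> flip" "{b, c} \<in> flip" "{c, d} \<in> flip" "{d, a} \<in> flip"
    "{b, d} \<in> flip" "{a, c} \<notin> flip"
    "{b, a} \<in> flip" "{c, b} \<in> flip" "{d, c} \<in> flip" "{a, d} \<in> flip" "{d, b} \<in> flip"
  using sides_distinct ab bc cd da by (auto simp: flip_def insert_commute)

text \<open>A triangle over \<open>{x, y}\<close> is lost only if \<open>{a, c}\<close> is one of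
  its other sides. Then \<open>{x, y}\<close> is a side of the quadrilateral, and the fourth vertex
  becomes its apex.\<close>

lemma flip_apex:
  assumes "{x, y} \<in> flip" "z < N" "cyc x z y"
  shows "\<exists>w<N. cyc x w y \<and> {x, w} \<in> flip \<and> {w, y} \<in> flip"
proof (cases "{x, y} = {b, d}")
  case True
  then consider "x = b" "y = d" | "x = d" "y = b"
    by (auto simp: doubleton_eq_iff)
  then show ?thesis
  proof cases
    case 1
    then show ?thesis
      using edgeD(2)[OF ac] flip_sides cyc_more by blast
  next
    case 2
    then show ?thesis
      using edgeD(1)[OF ac] flip_sides cyc_more by blast
  qed
next
  case False
  then have "{x, y} \<in> E" "{x, y} \<noteq> {a, c}" using assms(1) by (auto simp: flip_def)
  then obtain w where w: "w < N" "cyc x w y" "{x, w} \<in> E" "{w, y} \<in> E"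
    using apex assms(2,3) by blast
  consider "{x, w} = {a, c}" | "{w, y} = {a, c}" | "{x, w} \<in> flip" "{w, y} \<in> flip"
    using w unfolding flip_def by blast
  then show ?thesis
  proof cases
    case 1
    then have "arrow {a, c} {w, y}"
      using arrowI[of x w y] w \<open>{x, y} \<in> E\<close> by (simp add: insert_commute)
    then have wy: "{w, y} = {a, b} \<or> {w, y} = {c, d}" by (simp add: arrow_from_diagonal)
    then consider "w = a" "y = b" "x = c" | "w = c" "y = d" "x = a"
      using 1 quad_distinct by (auto simp: doubleton_eq_iff)
    then show ?thesis
    proof cases
      case 1
      then show ?thesis
        using edgeD(2)[OF cd] cyc_more flip_sides by blast
    next
      case 2
      then show ?thesis
        using edgeD(2)[OF ab] cyc_more flip_sides by blast
    qed
  next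
    case 2
    then have "arrow {x, w} {a, c}"
      using arrowI[of x w y] w \<open>{x, y} \<in> E\<close> by (simp add: insert_commute)
    then have wy: "{x, w} = {b, c} \<or> {x, w} = {d, a}" by (simp add: arrow_to_diagonal)
    then consider "x = b" "w = c" "y = a" | "x = d" "w = a" "y = c"
      using 2 quad_distinct by (auto simp: doubleton_eq_iff)
    then show ?thesis
    proof cases
      case 1
      then show ?thesis
        using edgeD(2)[OF cd] cyc_more flip_sides by blast
    next
      case 2
      then show ?thesis
        using edgeD(2)[OF ab] cyc_more flip_sides by blast
    qed
  qed (use w in blast)
qed

lemma flip_triangulated:
  assumes "{a, c} \<notin> boundary_edges N"
  shows "triangulated N flip"
proof
  show "3 \<le> N" by (rule size)
  show "boundary_edges N \<subseteq> flip"
    using boundary assms by (auto simp: flip_def)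
  have "{b, d} \<in> {{a, b} |a b. a < b \<and> b < N}"
    using edgeD[OF ab] edgeD[OF cd] quad_distinct by (intro pair_mem) auto
  then show "flip \<subseteq> {{a, b} |a b. a < b \<and> b < N}"
    using pairs by (auto simp: flip_def)
  have irrefl: "\<not> crosses {b, d} {b, d}"
    unfolding crosses_pair_iff by (auto simp: doubleton_eq_iff dest: cyc_distinct)
  show "\<not> crosses \<gamma> \<delta>" if "\<gamma> \<in> flip" "\<delta> \<in> flip" for \<gamma> \<delta>
  proof -
    have "\<gamma> = {b, d} \<or> \<gamma> \<in> E \<and> \<gamma> \<noteq> {a, c}" "\<delta> = {b, d} \<or> \<delta> \<in> E \<and> \<delta> \<noteq> {a, c}"
      using that by (auto simp: flip_def)
    then show ?thesis
      using irrefl noncrossing flip_noncrossing crosses_sym by metis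
  qed
qed (rule flip_apex)

lemma flip_quadrilateral:
  assumes "{a, c} \<notin> boundary_edges N"
  shows "quadrilateral N flip b c d a"
proof -
  interpret F: triangulated N flip by (rule flip_triangulated[OF assms])
  show ?thesis
    using cyc_more flip_sides by unfold_locales (auto simp: insert_commute)
qed

text \<open>A triangle that exists only before or only after the flip contains \<open>{a, c}\<close>
  or \<open>{b, d}\<close>. If that is its third side, the two remaining sides are neighbouring
  sides of the quadrilateral, which leaves two arrows to lose and two to gain.\<close>

lemma arrow_flip_iff:
  assumes "{a, c} \<notin> boundary_edges N" "\<gamma> \<noteq> {a, c}" "\<delta> \<noteq> {a, c}" "\<gamma> \<noteq> {b, d}" "\<delta> \<noteq> {b, d}"
  shows "triangulated.arrow flip \<gamma> \<delta> \<longleftrightarrow>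
    arrow \<gamma> \<delta> \<and> \<not> (\<gamma> = {a, b} \<and> \<delta> = {b, c}) \<and> \<not> (\<gamma> = {c, d} \<and> \<delta> = {d, a}) \<or>
    \<gamma> = {d, a} \<and> \<delta> = {a, b} \<or> \<gamma> = {b, c} \<and> \<delta> = {c, d}"
proof -
  interpret F: quadrilateral N flip b c d a by (rule flip_quadrilateral[OF assms(1)])
  have to: "\<gamma> = {a, b} \<and> \<delta> = {b, c} \<or> \<gamma> = {c, d} \<and> \<delta> = {d, a}"
    if arr: "arrow \<gamma> \<delta>" and notarr: "\<not> F.arrow \<gamma> \<delta>"
  proof -
    obtain x y z where xyz: "cyc x y z" "{x, y} \<in> E" "{y, z} \<in> E" "{z, x} \<in> E"
      "\<gamma> = {x, y}" "\<delta> = {y, z}"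
      using arr unfolding arrow_def by blast
    have "{x, y} \<in> flip" "{y, z} \<in> flip"
      using xyz assms(2,3) by (auto simp: flip_def)
    then have "{z, x} \<notin> flip"
      using notarr F.arrowI[OF xyz(1)] xyz(5,6) by blast
    then have "{z, x} = {a, c}"
      using xyz(4) unfolding flip_def by blast
    moreover have "arrow {y, z} {z, x}" "arrow {z, x} {x, y}"
      using xyz cyc_rotate by (blast intro: arrowI)+
    ultimately have "{y, z} = {b, c} \<or> {y, z} = {d, a}" "{x, y} = {a, b} \<or> {x, y} = {c, d}"
      by (simp_all add: arrow_to_diagonal arrow_from_diagonal)
    with \<open>{z, x} = {a, c}\<close> xyz show ?thesis
      using quad_distinct by (auto simp: doubleton_eq_iff)
  qed
  have from': "\<gamma> = {d, a} \<and> \<delta> = {a, b} \<or> \<gamma> = {b, c} \<and> \<delta> = {c, d}"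
    if arr: "F.arrow \<gamma> \<delta>" and notarr: "\<not> arrow \<gamma> \<delta>"
  proof -
    obtain x y z where xyz: "cyc x y z" "{x, y} \<in> flip" "{y, z} \<in> flip" "{z, x} \<in> flip"
      "\<gamma> = {x, y}" "\<delta> = {y, z}"
      using arr unfolding F.arrow_def by blast
    have "{x, y} \<in> E" "{y, z} \<in> E"
      using xyz assms(4,5) by (auto simp: flip_def)
    then have "{z, x} \<notin> E"
      using notarr arrowI[OF xyz(1)] xyz(5,6) by blast
    then have "{z, x} = {b, d}"
      using xyz(4) unfolding flip_def by blast
    moreover have "F.arrow {y, z} {z, x}" "F.arrow {z, x} {x, y}"
      using xyz cyc_rotate by (blast intro: F.arrowI)+
    ultimately have "{y, z} = {c, d} \<or> {y, z} = {a, b}" "{x, y} = {b, c} \<or> {x, y} = {d, a}"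
      by (simp_all add: F.arrow_to_diagonal F.arrow_from_diagonal)
    with \<open>{z, x} = {b, d}\<close> xyz show ?thesis
      using quad_distinct by (auto simp: doubleton_eq_iff)
  qed
  have "\<gamma> = {a, b} \<and> \<delta> = {b, c} \<longrightarrow> \<not> F.arrow \<gamma> \<delta>" "\<gamma> = {c, d} \<and> \<delta> = {d, a} \<longrightarrow> \<not> F.arrow \<gamma> \<delta>"
    "\<gamma> = {d, a} \<and> \<delta> = {a, b} \<longrightarrow> F.arrow \<gamma> \<delta>" "\<gamma> = {b, c} \<and> \<delta> = {c, d} \<longrightarrow> F.arrow \<gamma> \<delta>"
    using F.arrow_sides F.no_arrow_sides by simp_all
  with to from' show ?thesis
    by argo
qed

text \<open>The paths through \<open>{a, c}\<close> run from \<open>{b, c}\<close> or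
  \<open>{d, a}\<close> to \<open>{a, b}\<close> or \<open>{c, d}\<close>. Of the four arrows that
  mutation adds, those from \<open>{b, c}\<close> to \<open>{a, b}\<close> and from
  \<open>{d, a}\<close> to \<open>{c, d}\<close> cancel the arrows lost by the flip; the other two
  are the arrows gained.\<close>

lemma arrow_mutation:
  fixes s s' :: "nat set \<Rightarrow> nat set \<Rightarrow> int"
  defines "s \<equiv> \<lambda>\<gamma> \<delta>. of_bool (arrow \<gamma> \<delta>) - of_bool (arrow \<delta> \<gamma>)"
    and "s' \<equiv> \<lambda>\<gamma> \<delta>. of_bool (triangulated.arrow flip \<gamma> \<delta>) - of_bool (triangulated.arrow flip \<delta> \<gamma>)"
  assumes "{a, c} \<notin> boundary_edges N" "\<gamma> \<noteq> {a, c}" "\<delta> \<noteq> {a, c}" "\<gamma> \<noteq> {b, d}" "\<delta> \<noteq> {b, d}"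
  shows "s' \<gamma> \<delta> = s \<gamma> \<delta> + max (s \<gamma> {a, c}) 0 * max (s {a, c} \<delta>) 0 -
    max (- s \<gamma> {a, c}) 0 * max (- s {a, c} \<delta>) 0"
proof -
  note flip_iff = arrow_flip_iff[OF assms(3-7)] arrow_flip_iff[OF assms(3,5,4,7,6)]
  have distinct: "{a, b} \<noteq> {b, c}" "{a, b} \<noteq> {c, d}" "{a, b} \<noteq> {d, a}"
    "{b, c} \<noteq> {c, d}" "{b, c} \<noteq> {d, a}" "{c, d} \<noteq> {d, a}"
    using sides_distinct by simp_all
  note sides = arrow_sides no_arrow_sides arrow_sides[THEN arrow_asym]
  have cases: "\<epsilon> = {a, b} \<or> \<epsilon> = {b, c} \<or> \<epsilon> = {c, d} \<or> \<epsilon> = {d, a} \<or>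
    \<epsilon> \<noteq> {a, b} \<and> \<epsilon> \<noteq> {b, c} \<and> \<epsilon> \<noteq> {c, d} \<and> \<epsilon> \<noteq> {d, a}" for \<epsilon>
    by blast
  show ?thesis
    unfolding s_def s'_def flip_iff arrow_to_diagonal arrow_from_diagonal
    using cases[of \<gamma>] cases[of \<delta>]
    by (elim disjE conjE) (simp_all add: distinct distinct[symmetric] sides arrow_irrefl)
qed

lemma flip_arrow_diagonal:
  assumes "{a, c} \<notin> boundary_edges N"
  shows "triangulated.arrow flip \<gamma> {b, d} \<longleftrightarrow> arrow {a, c} \<gamma>"
    and "triangulated.arrow flip {b, d} \<gamma> \<longleftrightarrow> arrow \<gamma> {a, c}"
proof -
  interpret F: quadrilateral N flip b c d a by (rule flip_quadrilateral[OF assms])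
  show "F.arrow \<gamma> {b, d} \<longleftrightarrow> arrow {a, c} \<gamma>" "F.arrow {b, d} \<gamma> \<longleftrightarrow> arrow \<gamma> {a, c}"
    by (auto simp: arrow_to_diagonal arrow_from_diagonal F.arrow_to_diagonal F.arrow_from_diagonal)
qed

end


section \<open>Subtraction-free rational functions\<close>

definition nonneg_coeffs :: "((nat \<Rightarrow>\<^sub>0 nat) \<Rightarrow>\<^sub>0 rat) set"
  where "nonneg_coeffs = {p. p \<noteq> 0 \<and> (\<forall>k. 0 \<le> Poly_Mapping.lookup p k)}"

text \<open>Closed under sums, products and quotients, and without 0. Division in the field is
  total, with value 0 for the divisor 0, so nonvanishing has to be proved before the divisor of a
  mutation can be cancelled.\<close>

definition subtraction_free :: "ratfun set"
  where "subtraction_free = {Fract p q |p q. p \<in> nonneg_coeffs \<and> q \<in> nonneg_coeffs}"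

lemma nonneg_coeffs_add:
  assumes "p \<in> nonneg_coeffs" "q \<in> nonneg_coeffs"
  shows "p + q \<in> nonneg_coeffs"
proof -
  obtain k where "Poly_Mapping.lookup p k \<noteq> 0"
    using assms(1) by (metis (mono_tags) lookup_zero mem_Collect_eq nonneg_coeffs_def poly_mapping_eqI)
  moreover have "0 \<le> Poly_Mapping.lookup p k" "0 \<le> Poly_Mapping.lookup q k"
    using assms by (auto simp: nonneg_coeffs_def)
  ultimately have "Poly_Mapping.lookup (p + q) k \<noteq> 0"
    by (simp add: lookup_add)
  then have "p + q \<noteq> 0" by auto
  then show ?thesis
    using assms by (simp add: nonneg_coeffs_def lookup_add)
qed

lemma nonneg_coeffs_mult:
  assumes "p \<in> nonneg_coeffs" "q \<in> nonneg_coeffs"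
  shows "p * q \<in> nonneg_coeffs"
  using assms
  by (auto simp: nonneg_coeffs_def lookup_mult Sum_any.expand_set when_def
      intro!: sum_nonneg mult_nonneg_nonneg)

lemma subtraction_freeI: "p \<in> nonneg_coeffs \<Longrightarrow> q \<in> nonneg_coeffs \<Longrightarrow> Fract p q \<in> subtraction_free"
  unfolding subtraction_free_def by blast

lemma subtraction_freeE:
  assumes "x \<in> subtraction_free"
  obtains p q where "x = Fract p q" "p \<in> nonneg_coeffs" "q \<in> nonneg_coeffs" "p \<noteq> 0" "q \<noteq> 0"
  using assms unfolding subtraction_free_def nonneg_coeffs_def by blast

lemma subtraction_free_add: "x \<in> subtraction_free \<Longrightarrow> y \<in> subtraction_free \<Longrightarrow> x + y \<in> subtraction_free"
  by (elim subtraction_freeE)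
    (simp add: subtraction_freeI nonneg_coeffs_add nonneg_coeffs_mult)

lemma subtraction_free_mult: "x \<in> subtraction_free \<Longrightarrow> y \<in> subtraction_free \<Longrightarrow> x * y \<in> subtraction_free"
  by (elim subtraction_freeE) (simp add: subtraction_freeI nonneg_coeffs_mult)

lemma subtraction_free_divide: "x \<in> subtraction_free \<Longrightarrow> y \<in> subtraction_free \<Longrightarrow> x / y \<in> subtraction_free"
  by (elim subtraction_freeE) (simp add: subtraction_freeI nonneg_coeffs_mult)

lemma subtraction_free_nonzero: "x \<in> subtraction_free \<Longrightarrow> x \<noteq> 0"
  by (elim subtraction_freeE) (simp add: Zero_fract_def eq_fract)

lemma single_nonneg_coeffs: "0 < c \<Longrightarrow> Poly_Mapping.single k c \<in> nonneg_coeffs"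
  unfolding nonneg_coeffs_def
  by (auto simp: lookup_single when_def) (metis lookup_single_eq lookup_zero less_irrefl)

lemma one_nonneg_coeffs: "1 \<in> nonneg_coeffs"
  using single_nonneg_coeffs[of 1 0] by simp

lemma var_subtraction_free: "var i \<in> subtraction_free"
  unfolding var_def by (intro subtraction_freeI single_nonneg_coeffs one_nonneg_coeffs) simp

lemma one_subtraction_free: "1 \<in> subtraction_free"
  unfolding One_fract_def by (intro subtraction_freeI one_nonneg_coeffs)

lemma prod_power_subtraction_free:
  "(\<And>i. i \<in> I \<Longrightarrow> u i \<in> subtraction_free) \<Longrightarrow> (\<Prod>i\<in>I. u i ^ e i) \<in> subtraction_free"
proof (induction I rule: infinite_finite_induct)
  case (insert i I)
  have "u i ^ m \<in> subtraction_free" for m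
    using insert.prems by (induction m) (auto simp: one_subtraction_free subtraction_free_mult)
  then show ?case using insert by (simp add: subtraction_free_mult)
qed (simp_all add: one_subtraction_free)

lemma seeds_subtraction_free:
  assumes "(B, u) \<in> seeds n Q" "i \<in> {1..n}"
  shows "u i \<in> subtraction_free"
  using assms
proof (induction arbitrary: i rule: seeds.induct)
  case initial
  show ?case by (rule var_subtraction_free)
next
  case (mutation B u k)
  then show ?case
    by (auto simp: mutate_cluster_def
        intro!: subtraction_free_divide subtraction_free_add prod_power_subtraction_free)
qed


section \<open>Labelled triangulations and seeds\<close>

abbreviation edges :: "nat \<Rightarrow> (nat \<Rightarrow> nat set) \<Rightarrow> nat set set"
  where "edges n \<tau> \<equiv> \<tau> ` {1..n} \<union> boundary_edges (n + 3)"

locale labelled_triangulation = triangulated "n + 3" "edges n \<tau>"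
  for n :: nat and \<tau> :: "nat \<Rightarrow> nat set" +
  assumes inj: "inj_on \<tau> {1..n}"
    and interior: "\<tau> ` {1..n} \<inter> boundary_edges (n + 3) = {}"
begin

lemma label_not_boundary: "k \<in> {1..n} \<Longrightarrow> \<tau> k \<notin> boundary_edges (n + 3)"
  using interior by blast

lemma triangulation_quiver_iff:
  "(x, y) \<in> triangulation_quiver n \<tau> \<longleftrightarrow> x \<in> {1..n} \<and> y \<in> {1..n} \<and> arrow (\<tau> x) (\<tau> y)"
proof
  assume "(x, y) \<in> triangulation_quiver n \<tau>"
  then have xy: "x \<in> {1..n}" "y \<in> {1..n}"
    and "\<exists>a b c. a < b \<and> b < c \<and> c < n + 3 \<and> {{a, b}, {b, c}, {c, a}} \<subseteq> edges n \<tau> \<and>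
      (\<tau> x, \<tau> y) \<in> ccw_sides a b c"
    unfolding triangulation_quiver_def by simp_all
  then obtain a b c where "a < b" "b < c"
    and "{{a, b}, {b, c}, {c, a}} \<subseteq> edges n \<tau>" and ccw: "(\<tau> x, \<tau> y) \<in> ccw_sides a b c"
    by (elim exE conjE)
  then have abc: "{a, b} \<in> edges n \<tau>" "{b, c} \<in> edges n \<tau>" "{c, a} \<in> edges n \<tau>"
    by (simp_all only: insert_subset)
  from \<open>a < b\<close> \<open>b < c\<close> have "cyc a b c" "cyc b c a" "cyc c a b"
    by (simp_all add: cyc_def)
  with abc have "arrow {a, b} {b, c}" "arrow {b, c} {c, a}" "arrow {c, a} {a, b}"
    by (blast intro: arrowI)+
  then show "x \<in> {1..n} \<and> y \<in> {1..n} \<and> arrow (\<tau> x) (\<tau> y)"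
    using xy ccw unfolding ccw_sides_def by (elim insertE emptyE Pair_inject) simp_all
next
  assume xy: "x \<in> {1..n} \<and> y \<in> {1..n} \<and> arrow (\<tau> x) (\<tau> y)"
  then obtain a b c where abc: "cyc a b c" "{a, b} \<in> edges n \<tau>" "{b, c} \<in> edges n \<tau>" "{c, a} \<in> edges n \<tau>"
    and eq: "\<tau> x = {a, b}" "\<tau> y = {b, c}"
    unfolding arrow_def by blast
  have lt: "a < n + 3" "b < n + 3" "c < n + 3"
    using edgeD(1)[OF abc(2)] edgeD(1)[OF abc(3)] edgeD(1)[OF abc(4)] by auto
  have "\<exists>p q r. p < q \<and> q < r \<and> r < n + 3 \<and> {{p, q}, {q, r}, {r, p}} \<subseteq> edges n \<tau> \<and>
    (\<tau> x, \<tau> y) \<in> ccw_sides p q r"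
    using abc(1) unfolding cyc_def
  proof (elim disjE conjE)
    assume "a < b" "b < c"
    then show ?thesis
      using abc lt eq by (intro exI[of _ a] exI[of _ b] exI[of _ c]) (simp add: ccw_sides_def)
  next
    assume "b < c" "c < a"
    then show ?thesis
      using abc lt eq by (intro exI[of _ b] exI[of _ c] exI[of _ a]) (simp add: ccw_sides_def)
  next
    assume "c < a" "a < b"
    then show ?thesis
      using abc lt eq by (intro exI[of _ c] exI[of _ a] exI[of _ b]) (simp add: ccw_sides_def)
  qed
  with xy show "(x, y) \<in> triangulation_quiver n \<tau>"
    unfolding triangulation_quiver_def by blast
qed

lemma quiver_matrix_eq:
  "x \<in> {1..n} \<Longrightarrow> y \<in> {1..n} \<Longrightarrow> quiver_matrix (triangulation_quiver n \<tau>) x y =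
    of_bool (arrow (\<tau> x) (\<tau> y)) - of_bool (arrow (\<tau> y) (\<tau> x))"
  by (simp add: quiver_matrix_def triangulation_quiver_iff)

lemma quadrilateral_exists:
  assumes "k \<in> {1..n}"
  shows "\<exists>a b c d. \<tau> k = {a, c} \<and> quadrilateral (n + 3) (edges n \<tau>) a b c d"
proof -
  have mem: "\<tau> k \<in> edges n \<tau>" and notb: "\<tau> k \<notin> boundary_edges (n + 3)"
    using assms interior by blast+
  obtain a c where ac: "\<tau> k = {a, c}" "a < c" "c < n + 3"
    using mem pairs by blast
  then have E: "{a, c} \<in> edges n \<tau>" "{c, a} \<in> edges n \<tau>"
    using mem by (simp_all add: insert_commute)
  have less: "Suc z mod (n + 3) < n + 3" for z
    by simp
  \<comment> \<open>As the label is not a boundary edge, the successor of each endpoint lies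
    strictly inside the adjacent arc, and \<open>apex\<close> applies on both sides.\<close>
  have "cyc a (Suc a mod (n + 3)) c" "cyc c (Suc c mod (n + 3)) a"
    using ac notb cyc_next[of a "n + 3" c] cyc_next[of c "n + 3" a] by (simp_all add: insert_commute)
  from apex[OF E(1) less this(1)] apex[OF E(2) less this(2)]
  obtain b d where "cyc a b c" "{a, b} \<in> edges n \<tau>" "{b, c} \<in> edges n \<tau>"
    "cyc c d a" "{c, d} \<in> edges n \<tau>" "{d, a} \<in> edges n \<tau>"
    by blast
  then have "quadrilateral (n + 3) (edges n \<tau>) a b c d"
    using E by unfold_locales
  with ac show ?thesis by blast
qed

text \<open>The product over labels in a mutation sees only those sides of the quadrilateral that
  are diagonals. Extending it by the boundary edges, all of value 1, treats diagonal and boundary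
  sides uniformly.\<close>

lemma side_product:
  fixes X :: "nat set \<Rightarrow> ratfun"
  assumes "\<And>e. e \<in> boundary_edges (n + 3) \<Longrightarrow> X e = 1"
    and "p \<in> edges n \<tau>" "q \<in> edges n \<tau>" "p \<noteq> q"
  shows "(\<Prod>i=1..n. if \<tau> i = p \<or> \<tau> i = q then X (\<tau> i) else 1) = X p * X q"
proof -
  define g where "g \<gamma> = (if \<gamma> = p \<or> \<gamma> = q then X \<gamma> else 1)" for \<gamma>
  have fin: "finite (edges n \<tau>)"
    by (simp add: boundary_edges_def)
  have "(\<Prod>i=1..n. g (\<tau> i)) = prod g (\<tau> ` {1..n})"
    using inj by (simp add: prod.reindex)
  also have "\<dots> = prod g (edges n \<tau>)"
    using fin assms(1) by (intro prod.mono_neutral_left) (auto simp: g_def)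
  also have "\<dots> = prod g {p, q}"
    using fin assms(2,3) by (intro prod.mono_neutral_right) (auto simp: g_def)
  also have "\<dots> = X p * X q"
    using assms(4) by (simp add: g_def)
  finally show ?thesis
    by (simp add: g_def)
qed

end

lemma ptolemy_cyc:
  assumes "ptolemy_function n \<tau> X" "cyc a b c" "cyc c d a"
    and "a < n + 3" "b < n + 3" "c < n + 3" "d < n + 3"
  shows "X {a, c} * X {b, d} = X {a, b} * X {c, d} + X {b, c} * X {a, d}"
proof -
  have sorted: "X {a, c} * X {b, d} = X {a, b} * X {c, d} + X {b, c} * X {a, d}"
    if "a < b" "b < c" "c < d" "d < n + 3" for a b c d
    using assms(1) that unfolding ptolemy_function_def by blast
  from assms(2,3) consider "a < b" "b < c" "c < d" | "b < c" "c < d" "d < a" | "c < d" "d < a" "a < b"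
    | "d < a" "a < b" "b < c"
    by (auto simp: cyc_def)
  then show ?thesis
  proof cases
    case 1
    then show ?thesis using sorted assms by blast
  next
    case 2
    then show ?thesis using sorted[of b c d a] assms by (simp add: insert_commute algebra_simps)
  next
    case 3
    then show ?thesis using sorted[of c d a b] assms by (simp add: insert_commute algebra_simps)
  next
    case 4
    then show ?thesis using sorted[of d a b c] assms by (simp add: insert_commute algebra_simps)
  qed
qed

text \<open>The cluster is compared with every solution \<open>X\<close> for the initial labelling
  at once. Two solutions therefore agree wherever a represented seed has a diagonal, independently
  of whether a solution exists.\<close>

definition represents :: "nat \<Rightarrow> (nat \<Rightarrow> nat set) \<Rightarrow> seed \<Rightarrow> (nat \<Rightarrow> nat set) \<Rightarrow> bool"
  where "represents n \<tau>\<^sub>0 S \<tau> \<longleftrightarrow> labelled_triangulation n \<tau> \<and>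
    (\<forall>i\<in>{1..n}. \<forall>j\<in>{1..n}. fst S i j = quiver_matrix (triangulation_quiver n \<tau>) i j) \<and>
    (\<forall>X. ptolemy_function n \<tau>\<^sub>0 X \<longrightarrow> (\<forall>i\<in>{1..n}. snd S i = X (\<tau> i)))"

lemma represents_mutation:
  assumes rep: "represents n \<tau>\<^sub>0 (B, u) \<tau>" and nonzero: "u k \<noteq> 0" and k: "k \<in> {1..n}"
    and ac: "\<tau> k = {a, c}" and quad: "quadrilateral (n + 3) (edges n \<tau>) a b c d"
  shows "represents n \<tau>\<^sub>0 (mutate_matrix k B, mutate_cluster n k B u) (\<tau>(k := {b, d}))"
proof -
  let ?\<tau>' = "\<tau>(k := {b, d})"
  interpret L: labelled_triangulation n \<tau>
    using rep by (simp add: represents_def)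
  interpret q: quadrilateral "n + 3" "edges n \<tau>" a b c d
    by (rule quad)
  have B: "B i j = of_bool (L.arrow (\<tau> i) (\<tau> j)) - of_bool (L.arrow (\<tau> j) (\<tau> i))"
    if "i \<in> {1..n}" "j \<in> {1..n}" for i j
    using rep that L.quiver_matrix_eq by (simp add: represents_def)
  have notb: "{a, c} \<notin> boundary_edges (n + 3)"
    using L.label_not_boundary[OF k] ac by simp
  have other: "\<tau> i \<noteq> {a, c}" "\<tau> i \<noteq> {b, d}" if "i \<in> {1..n}" "i \<noteq> k" for i
  proof -
    show "\<tau> i \<noteq> {a, c}"
      using inj_onD[OF L.inj, of i k] that k ac by auto
    have "\<tau> i \<in> edges n \<tau>"
      using that(1) by blast
    then show "\<tau> i \<noteq> {b, d}"
      using q.bd_notin by metis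
  qed
  have "?\<tau>' ` {1..n} = insert {b, d} (\<tau> ` ({1..n} - {k}))"
    using k by auto
  also have "\<tau> ` ({1..n} - {k}) = \<tau> ` {1..n} - {{a, c}}"
    using k ac other(1) by auto
  finally have image: "?\<tau>' ` {1..n} = insert {b, d} (\<tau> ` {1..n} - {{a, c}})" .
  have edges: "edges n ?\<tau>' = q.flip"
    unfolding image q.flip_def using notb by blast
  interpret L': labelled_triangulation n ?\<tau>'
  proof (intro labelled_triangulation.intro labelled_triangulation_axioms.intro)
    show "triangulated (n + 3) (edges n ?\<tau>')"
      unfolding edges by (rule q.flip_triangulated[OF notb])
    show "inj_on ?\<tau>' {1..n}"
    proof (rule inj_onI)
      fix i j assume "i \<in> {1..n}" "j \<in> {1..n}" "?\<tau>' i = ?\<tau>' j"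
      then show "i = j"
        using other(2)[of i] other(2)[of j] inj_onD[OF L.inj, of i j]
        by (cases "i = k"; cases "j = k") simp_all
    qed
    show "?\<tau>' ` {1..n} \<inter> boundary_edges (n + 3) = {}"
      unfolding image using L.interior q.bd_notin by blast
  qed
  have "mutate_matrix k B i j = quiver_matrix (triangulation_quiver n ?\<tau>') i j"
    if ij: "i \<in> {1..n}" "j \<in> {1..n}" for i j
  proof -
    have upd: "?\<tau>' k = {b, d}" "\<And>l. l \<noteq> k \<Longrightarrow> ?\<tau>' l = \<tau> l"
      by simp_all
    have eq: "quiver_matrix (triangulation_quiver n ?\<tau>') i j =
        of_bool (triangulated.arrow q.flip (?\<tau>' i) (?\<tau>' j)) - of_bool (triangulated.arrow q.flip (?\<tau>' j) (?\<tau>' i))"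
      using L'.quiver_matrix_eq[OF ij] by (simp only: edges)
    consider "i = k" "j = k" | "i = k" "j \<noteq> k" | "i \<noteq> k" "j = k" | "i \<noteq> k" "j \<noteq> k"
      by blast
    then show ?thesis
    proof cases
      case 1
      then show ?thesis
        unfolding eq using B[OF k k] by (simp add: mutate_matrix_def)
    next
      case 2
      then have "mutate_matrix k B i j = - B i j"
        by (simp add: mutate_matrix_def)
      then show ?thesis
        unfolding eq B[OF ij] unfolding 2(1) upd(1) upd(2)[OF 2(2)] ac q.flip_arrow_diagonal[OF notb]
        by (simp only: minus_diff_eq)
    next
      case 3
      then have "mutate_matrix k B i j = - B i j"
        by (simp add: mutate_matrix_def)
      then show ?thesis
        unfolding eq B[OF ij] unfolding 3(2) upd(1) upd(2)[OF 3(1)] ac q.flip_arrow_diagonal[OF notb]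
        by (simp only: minus_diff_eq)
    next
      case 4
      then have "mutate_matrix k B i j =
          B i j + max (B i k) 0 * max (B k j) 0 - max (- B i k) 0 * max (- B k j) 0"
        by (simp add: mutate_matrix_def)
      then show ?thesis
        unfolding eq upd(2)[OF 4(1)] upd(2)[OF 4(2)] B[OF ij] B[OF ij(1) k] B[OF k ij(2)] ac
          q.arrow_mutation[OF notb other(1)[OF ij(1) 4(1)] other(1)[OF ij(2) 4(2)]
            other(2)[OF ij(1) 4(1)] other(2)[OF ij(2) 4(2)]] .
    qed
  qed
  moreover have "mutate_cluster n k B u i = X (?\<tau>' i)"
    if X: "ptolemy_function n \<tau>\<^sub>0 X" and i: "i \<in> {1..n}" for X i
  proof (cases "i = k")
    case True
    have u: "u j = X (\<tau> j)" if "j \<in> {1..n}" for j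
      using rep X that by (simp add: represents_def)
    have X1: "X e = 1" if "e \<in> boundary_edges (n + 3)" for e
      using X that by (simp add: ptolemy_function_def)
    have ne: "{a, b} \<noteq> {b, c}" "{b, c} \<noteq> {c, d}" "{a, b} \<noteq> {d, a}" "{c, d} \<noteq> {d, a}"
      "{b, c} \<noteq> {d, a}" "{a, b} \<noteq> {c, d}"
      using q.sides_distinct by simp_all
    \<comment> \<open>A matrix entry is the difference of two truth values that exclude each other,
      so the power is the variable itself or 1.\<close>
    have pow: "x ^ nat (of_bool P - of_bool R) = (if P then x else 1)"
      "x ^ nat (- (of_bool P - of_bool R)) = (if R then x else 1)"
      if "\<not> (P \<and> R)" for P R and x :: ratfun
      using that by (cases P; cases R; simp)+
    have "u j ^ nat (B j k) = (if \<tau> j = {b, c} \<or> \<tau> j = {d, a} then X (\<tau> j) else 1)"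
      "u j ^ nat (- B j k) = (if \<tau> j = {a, b} \<or> \<tau> j = {c, d} then X (\<tau> j) else 1)"
      if j: "j \<in> {1..n}" for j
    proof -
      have "\<not> ((\<tau> j = {b, c} \<or> \<tau> j = {d, a}) \<and> (\<tau> j = {a, b} \<or> \<tau> j = {c, d}))"
        using ne by metis
      from pow[OF this] show "u j ^ nat (B j k) = (if \<tau> j = {b, c} \<or> \<tau> j = {d, a} then X (\<tau> j) else 1)"
        "u j ^ nat (- B j k) = (if \<tau> j = {a, b} \<or> \<tau> j = {c, d} then X (\<tau> j) else 1)"
        unfolding B[OF j k] u[OF j] ac q.arrow_to_diagonal q.arrow_from_diagonal .
    qed
    then have "mutate_cluster n k B u k = (X {b, c} * X {d, a} + X {a, b} * X {c, d}) / u k"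
      using L.side_product[where X = X, OF X1 q.bc q.da ne(5)] L.side_product[where X = X, OF X1 q.ab q.cd ne(6)]
      by (simp add: mutate_cluster_def)
    also have "\<dots> = (X {a, c} * X {b, d}) / u k"
      using ptolemy_cyc[OF X q.cyc_abc q.cyc_cda] L.edgeD[OF q.ab] L.edgeD[OF q.cd]
      by (simp add: insert_commute algebra_simps)
    also have "\<dots> = X {b, d}"
      using nonzero u[OF k] ac by simp
    finally show ?thesis
      using True by simp
  next
    case False
    then show ?thesis
      using rep X i by (simp add: represents_def mutate_cluster_def)
  qed
  ultimately show ?thesis
    unfolding represents_def using L'.labelled_triangulation_axioms by simp
qed

lemma seed_represented:
  assumes "represents n \<tau>\<^sub>0 (quiver_matrix Q, var) \<tau>\<^sub>0" "(B, u) \<in> seeds n Q"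
  shows "\<exists>\<tau>. represents n \<tau>\<^sub>0 (B, u) \<tau>"
  using assms(2)
proof (induction rule: seeds.induct)
  case initial
  then show ?case using assms(1) by blast
next
  case (mutation B u k)
  then obtain \<tau> where \<tau>: "represents n \<tau>\<^sub>0 (B, u) \<tau>" by blast
  then have "labelled_triangulation n \<tau>"
    by (simp add: represents_def)
  from labelled_triangulation.quadrilateral_exists[OF this mutation(2)]
  obtain a b c d where quad: "\<tau> k = {a, c}" "quadrilateral (n + 3) (edges n \<tau>) a b c d"
    by (elim exE conjE)
  have nonzero: "u k \<noteq> 0"
    using seeds_subtraction_free[OF mutation(1,2)] by (rule subtraction_free_nonzero)
  show ?case
    by (rule exI[of _ "\<tau>(k := {b, d})"]) (rule represents_mutation[OF \<tau> nonzero mutation(2) quad])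
qed

text \<open>
  Flipping the first diagonal that \<open>{p, q}\<close> crosses on its way from \<open>p\<close> yields a diagonal ending
  at \<open>p\<close>, so the number of crossings with \<open>{p, q}\<close> drops.
\<close>

lemma diagonal_reached:
  assumes "represents n \<tau>\<^sub>0 (B, u) \<tau>" "(B, u) \<in> seeds n Q"
    and "p < n + 3" "q < n + 3" "p \<noteq> q" "{p, q} \<notin> boundary_edges (n + 3)"
  shows "\<exists>B u \<tau> i. represents n \<tau>\<^sub>0 (B, u) \<tau> \<and> (B, u) \<in> seeds n Q \<and> i \<in> {1..n} \<and> \<tau> i = {p, q}"
  using assms(1,2)
proof (induction "card {i \<in> {1..n}. crosses {p, q} (\<tau> i)}" arbitrary: B u \<tau> rule: less_induct)
  case less
  let ?E = "edges n \<tau>"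
  interpret L: labelled_triangulation n \<tau>
    using less.prems(1) by (simp add: represents_def)
  show ?case
  proof (cases "{p, q} \<in> ?E")
    case True
    then show ?thesis
      using assms(6) less.prems by (metis (no_types, lifting) UnE imageE)
  next
    case False
    have "Suc p mod (n + 3) < n + 3" by simp
    then obtain x where x: "x < n + 3" "cyc p x q" "{p, x} \<in> ?E"
      and far: "\<And>z. z < n + 3 \<Longrightarrow> cyc x z q \<Longrightarrow> {p, z} \<notin> ?E"
      using farthest_vertex[of "Suc p mod (n + 3)" "n + 3" p q "\<lambda>z. {p, z} \<in> ?E"]
        cyc_next[OF assms(3-6)] L.next_edge[OF assms(3)] by metis
    have "cyc x q p" using x(2) by (rule cyc_rotate)
    moreover have "{x, p} \<in> ?E"
      using x(3) by (simp only: insert_commute)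
    ultimately obtain y where y: "y < n + 3" "cyc x y p" "{x, y} \<in> ?E" "{y, p} \<in> ?E"
      using L.apex[of x p q] assms(4) by blast
    have "{p, y} \<in> ?E"
      using y(4) by (simp only: insert_commute)
    \<comment> \<open>The apex \<open>q\<close> would make \<open>{p, q}\<close> an edge, and an
      apex before \<open>q\<close> would be a later spoke at \<open>p\<close> than \<open>x\<close>.
      So \<open>{x, y}\<close> separates \<open>p\<close> from \<open>q\<close>.\<close>
    then have "y \<noteq> q" "\<not> cyc x y q"
      using False far[OF y(1)] by blast+
    then have qyp: "cyc q y p"
      using cyc_split[OF y(2) \<open>cyc x q p\<close>] by blast
    then have cross: "crosses {p, q} {x, y}"
      using crossesI x(2) by blast
    then have "{x, y} \<notin> boundary_edges (n + 3)"
      using boundary_not_crossed[of "{x, y}" "n + 3" "{p, q}"] assms(3,4) crosses_sym by auto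
    then obtain k where k: "k \<in> {1..n}" "\<tau> k = {x, y}"
      using y(3) by auto
    have "cyc x q y"
      using cyc_trans'[of p x q y] x(2) qyp cyc_rotate by blast
    then obtain b where "cyc x b y" "{x, b} \<in> ?E" "{b, y} \<in> ?E"
      using L.apex[OF y(3) assms(4)] by blast
    then have "quadrilateral (n + 3) ?E x b y p"
      using \<open>{p, x} \<in> ?E\<close> y cyc_rotate[OF y(2)] by unfold_locales
    moreover have "u k \<noteq> 0"
      using seeds_subtraction_free[OF less.prems(2) k(1)] by (rule subtraction_free_nonzero)
    ultimately have rep: "represents n \<tau>\<^sub>0 (mutate_matrix k B, mutate_cluster n k B u) (\<tau>(k := {b, p}))"
      by (intro represents_mutation[OF less.prems(1) _ k])
    have "\<not> crosses {p, q} {b, p}"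
      unfolding crosses_pair_iff by (auto simp: doubleton_eq_iff dest: cyc_distinct)
    then have "{i \<in> {1..n}. crosses {p, q} ((\<tau>(k := {b, p})) i)} \<subset> {i \<in> {1..n}. crosses {p, q} (\<tau> i)}"
      using k cross by auto
    then have "card {i \<in> {1..n}. crosses {p, q} ((\<tau>(k := {b, p})) i)} < card {i \<in> {1..n}. crosses {p, q} (\<tau> i)}"
      by (intro psubset_card_mono) auto
    from less.hyps[OF this rep seeds.mutation[OF less.prems(2) k(1)]] show ?thesis .
  qed
qed


section \<open>The function of the Ptolemy relations\<close>

text \<open>
  In terms of plane vectors, the Ptolemy relation is the Pluecker relation between determinants.
  Across a triangle \<open>a, b, c\<close> the vector at \<open>b\<close> is determined by those at \<open>a\<close> and \<open>c\<close>.
\<close>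

lemma (in triangulated) vectors_exist:
  fixes w :: "nat set \<Rightarrow> 'a::field"
  defines "det \<equiv> \<lambda>x y :: 'a \<times> 'a. fst x * snd y - snd x * fst y"
  assumes nonzero: "\<And>\<gamma>. \<gamma> \<in> E \<Longrightarrow> w \<gamma> \<noteq> 0"
    and "a < c" "{a, c} \<in> E" "det va vc = w {a, c}"
  shows "\<exists>v. v a = va \<and> v c = vc \<and>
    (\<forall>i j. a \<le> i \<and> i < j \<and> j \<le> c \<and> {i, j} \<in> E \<longrightarrow> det (v i) (v j) = w {i, j})"
  using assms(3-5)
proof (induction "c - a" arbitrary: a c va vc rule: less_induct)
  case less
  show ?case
  proof (cases "c = Suc a")
    case True
    define v where "v x = (if x = a then va else vc)" for x
    have "det (v i) (v j) = w {i, j}" if "a \<le> i" "i < j" "j \<le> c" for i j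
    proof -
      have "i = a" "j = c" using that True by arith+
      then show ?thesis using less.prems by (simp add: v_def)
    qed
    moreover have "v a = va" "v c = vc"
      using less.prems(1) by (simp_all add: v_def)
    ultimately show ?thesis by blast
  next
    case False
    then have "cyc a (Suc a) c" "Suc a < N"
      using less.prems(1) edgeD(2)[OF less.prems(2)] by (auto simp: cyc_def)
    then obtain b where b: "cyc a b c" "{a, b} \<in> E" "{b, c} \<in> E"
      using apex[OF less.prems(2)] by blast
    have lt: "a < b" "b < c"
      using b(1) less.prems(1) by (auto simp: cyc_def)
    \<comment> \<open>Cramer's rule: the determinants with \<open>va\<close> and \<open>vc\<close>
      are prescribed as \<open>w {a, b}\<close> and \<open>w {b, c}\<close>, and that of
      \<open>va\<close> and \<open>vc\<close> is \<open>w {a, c}\<close>.\<close>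
    define vb where "vb = ((w {b, c} * fst va + w {a, b} * fst vc) / w {a, c},
      (w {b, c} * snd va + w {a, b} * snd vc) / w {a, c})"
    have "det va vb = w {a, b} * det va vc / w {a, c}" "det vb vc = w {b, c} * det va vc / w {a, c}"
      using nonzero[OF less.prems(2)] by (simp_all add: det_def vb_def field_simps)
    then have "det va vb = w {a, b}" "det vb vc = w {b, c}"
      using less.prems nonzero[OF less.prems(2)] by simp_all
    moreover have "b - a < c - a" "c - b < c - a"
      using lt by simp_all
    ultimately have "\<exists>v. v a = va \<and> v b = vb \<and>
        (\<forall>i j. a \<le> i \<and> i < j \<and> j \<le> b \<and> {i, j} \<in> E \<longrightarrow> det (v i) (v j) = w {i, j})"
      and "\<exists>v. v b = vb \<and> v c = vc \<and>
        (\<forall>i j. b \<le> i \<and> i < j \<and> j \<le> c \<and> {i, j} \<in> E \<longrightarrow> det (v i) (v j) = w {i, j})"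
      using less.hyps[of b a va vb] less.hyps[of c b vb vc] lt b(2,3) by simp_all
    then obtain v1 v2 where v1: "v1 a = va" "v1 b = vb"
        "\<And>i j. a \<le> i \<Longrightarrow> i < j \<Longrightarrow> j \<le> b \<Longrightarrow> {i, j} \<in> E \<Longrightarrow> det (v1 i) (v1 j) = w {i, j}"
      and v2: "v2 b = vb" "v2 c = vc"
        "\<And>i j. b \<le> i \<Longrightarrow> i < j \<Longrightarrow> j \<le> c \<Longrightarrow> {i, j} \<in> E \<Longrightarrow> det (v2 i) (v2 j) = w {i, j}"
      by (elim exE conjE) simp
    define v where "v x = (if x \<le> b then v1 x else v2 x)" for x
    have v_right: "v x = v2 x" if "b \<le> x" for x
      using that v1(2) v2(1) by (auto simp: v_def)
    have "det (v i) (v j) = w {i, j}"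
      if ij: "a \<le> i" "i < j" "j \<le> c" "{i, j} \<in> E" for i j
    proof -
      consider "j \<le> b" | "b \<le> i" | "i < b" "b < j"
        by linarith
      then show ?thesis
      proof cases
        case 1
        then show ?thesis using v1(3) ij by (simp add: v_def)
      next
        case 2
        then show ?thesis using v2(3) ij by (simp add: v_right)
      next
        case 3
        \<comment> \<open>An edge with \<open>b\<close> strictly between its ends crosses
          \<open>{a, b}\<close> or \<open>{b, c}\<close> unless it is \<open>{a, c}\<close>
          itself.\<close>
        have "\<not> a < i"
          using not_cross[OF b(2) ij(4)] 3 by (auto simp: cyc_def)
        then have "i = a" using ij(1) by simp
        have "{j, i} \<in> E" using ij(4) by (simp only: insert_commute)
        then have "\<not> j < c"
          using not_cross[OF b(3), of j i] 3 lt \<open>i = a\<close> by (auto simp: cyc_def)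
        then show ?thesis
          using \<open>i = a\<close> ij(3) lt less.prems(3) v1(1) v2(2) by (simp add: v_def)
      qed
    qed
    moreover have "v a = va" "v c = vc"
      using lt v1(1) v2(2) by (simp_all add: v_def)
    ultimately show ?thesis by blast
  qed
qed

lemma (in labelled_triangulation) ptolemy_exists: "\<exists>X. ptolemy_function n \<tau> X"
proof -
  \<comment> \<open>The default 1 gives the boundary edges their value and makes \<open>w\<close>
    nonzero everywhere, as the divisions in \<open>vectors_exist\<close> demand.\<close>
  define w where "w \<gamma> = (if \<gamma> \<in> \<tau> ` {1..n} then var (inv_into {1..n} \<tau> \<gamma>) else 1)" for \<gamma>
  define det :: "ratfun \<times> ratfun \<Rightarrow> ratfun \<times> ratfun \<Rightarrow> ratfun"
    where "det x y = fst x * snd y - snd x * fst y" for x y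
  have w_var: "w (\<tau> i) = var i" if "i \<in> {1..n}" for i
    using that inj by (simp add: w_def)
  have w_boundary: "w e = 1" if "e \<in> boundary_edges (n + 3)" for e
  proof -
    have "e \<notin> \<tau> ` {1..n}" using that interior by blast
    then show ?thesis unfolding w_def by (rule if_not_P)
  qed
  have nonzero: "w \<gamma> \<noteq> 0" for \<gamma>
    using subtraction_free_nonzero[OF var_subtraction_free] by (simp add: w_def)
  have "Suc (n + 2) mod (n + 3) = 0"
    by (simp add: numeral_3_eq_3)
  \<comment> \<open>The construction starts from the boundary edge that closes the polygon. Its
    value 1 is the determinant of the two standard basis vectors, and all other vertices lie on one
    side of it.\<close>
  then have base: "{0, n + 2} \<in> boundary_edges (n + 3)"
    using boundary_edge_mem[of "n + 2" "n + 3"] by (simp only: insert_commute)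
  then have "w {0, n + 2} = det (1, 0) (0, 1)"
    using w_boundary by (simp add: det_def)
  then have "\<exists>v. v 0 = (1, 0) \<and> v (n + 2) = (0, 1) \<and>
      (\<forall>i j. 0 \<le> i \<and> i < j \<and> j \<le> n + 2 \<and> {i, j} \<in> edges n \<tau> \<longrightarrow> det (v i) (v j) = w {i, j})"
    unfolding det_def using nonzero base by (intro vectors_exist) simp_all
  then obtain v where v: "\<forall>i j. 0 \<le> i \<and> i < j \<and> j \<le> n + 2 \<and> {i, j} \<in> edges n \<tau> \<longrightarrow> det (v i) (v j) = w {i, j}"
    by (elim exE conjE)
  \<comment> \<open>The determinant is antisymmetric but \<open>X\<close> is a function of unordered
    pairs; \<open>Min\<close> and \<open>Max\<close> fix the sign.\<close>
  define X where "X \<gamma> = det (v (Min \<gamma>)) (v (Max \<gamma>))" for \<gamma>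
  have X: "X {i, j} = det (v i) (v j)" if "i < j" for i j
    using that by (simp add: X_def)
  have X_edge: "X \<gamma> = w \<gamma>" if edge: "\<gamma> \<in> edges n \<tau>" for \<gamma>
  proof -
    obtain i j where ij: "\<gamma> = {i, j}" "i < j" "j < n + 3"
      using subsetD[OF pairs edge] by blast
    then have "0 \<le> i \<and> i < j \<and> j \<le> n + 2 \<and> {i, j} \<in> edges n \<tau>"
      using edge by simp
    then show ?thesis
      unfolding ij(1) X[OF ij(2)] by (rule v[rule_format])
  qed
  have "ptolemy_function n \<tau> X"
    unfolding ptolemy_function_def
  proof (intro conjI ballI allI impI)
    fix i assume "i \<in> {1..n}"
    then show "X (\<tau> i) = var i"
      using X_edge[of "\<tau> i"] w_var by simp
  next
    fix e assume "e \<in> boundary_edges (n + 3)"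
    then show "X e = 1"
      using X_edge[of e] w_boundary by simp
  next
    fix a b c d :: nat
    assume "a < b \<and> b < c \<and> c < d \<and> d < n + 3"
    then show "X {a, c} * X {b, d} = X {a, b} * X {c, d} + X {b, c} * X {a, d}"
      by (simp add: X det_def algebra_simps)
  qed
  then show ?thesis by blast
qed

text \<open>The apex \<open>b\<close> is the last vertex before \<open>c\<close> joined to
  \<open>a\<close>. If \<open>{b, c}\<close> were missing, maximality would give a diagonal crossing
  it; ending at \<open>a\<close> it would contradict the choice of \<open>b\<close>, and otherwise
  it crosses \<open>{a, c}\<close> or \<open>{a, b}\<close>.\<close>

lemma triangulation_triangulated:
  assumes T: "is_triangulation N T" and "3 \<le> N"
  shows "triangulated N (T \<union> boundary_edges N)"
proof -
  let ?E = "T \<union> boundary_edges N"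
  have Tsub: "T \<subseteq> diagonals N" and Tnc: "\<And>\<gamma> \<delta>. \<gamma> \<in> T \<Longrightarrow> \<delta> \<in> T \<Longrightarrow> \<not> crosses \<gamma> \<delta>"
    and Tmax: "\<And>\<gamma>. \<gamma> \<in> diagonals N - T \<Longrightarrow> \<exists>\<delta>\<in>T. crosses \<gamma> \<delta>"
    using T by (simp_all add: is_triangulation_def)
  have diagonal_pairs: "diagonals N \<subseteq> {{a, b} |a b. a < b \<and> b < N}"
    unfolding diagonals_def by (rule Diff_subset)
  have boundary_pairs: "boundary_edges N \<subseteq> {{a, b} |a b. a < b \<and> b < N}"
    using boundary_edge_pair[of _ N] assms(2) by (intro subsetI) simp
  have pairs: "?E \<subseteq> {{a, b} |a b. a < b \<and> b < N}"
    by (rule Un_least[OF subset_trans[OF Tsub diagonal_pairs] boundary_pairs])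
  have sub: "\<gamma> \<subseteq> {..<N}" if edge: "\<gamma> \<in> ?E" for \<gamma>
  proof -
    obtain a b where "\<gamma> = {a, b}" "a < b" "b < N"
      using subsetD[OF pairs edge] by blast
    then show ?thesis by simp
  qed
  have noncrossing: "\<not> crosses \<gamma> \<delta>" if mem: "\<gamma> \<in> ?E" "\<delta> \<in> ?E" for \<gamma> \<delta>
  proof -
    consider "\<gamma> \<in> T" "\<delta> \<in> T" | "\<gamma> \<in> boundary_edges N" | "\<delta> \<in> boundary_edges N"
      using mem by blast
    then show ?thesis
    proof cases
      case 1
      then show ?thesis by (rule Tnc)
    next
      case 2
      then show ?thesis using boundary_not_crossed sub[OF mem(2)] by blast
    next
      case 3
      then show ?thesis using boundary_not_crossed[OF 3 sub[OF mem(1)]] crosses_sym by blast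
    qed
  qed
  show ?thesis
  proof
    show "3 \<le> N" by fact
    show "boundary_edges N \<subseteq> ?E" by blast
    show "?E \<subseteq> {{a, b} |a b. a < b \<and> b < N}" by (rule pairs)
    show "\<not> crosses \<gamma> \<delta>" if "\<gamma> \<in> ?E" "\<delta> \<in> ?E" for \<gamma> \<delta>
      by (rule noncrossing[OF that])
  next
    fix a c z assume ac: "{a, c} \<in> ?E" and z: "z < N" "cyc a z c"
    have less: "a < N" "c < N"
      using sub[OF ac] by auto
    have "cyc a (Suc a mod N) c"
      using less z by (cases "Suc a = N") (auto simp: cyc_def)
    moreover have "{a, Suc a mod N} \<in> ?E" "Suc a mod N < N"
      using boundary_edge_mem[OF less(1)] less by auto
    ultimately obtain b where b: "b < N" "cyc a b c" "{a, b} \<in> ?E"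
      and far: "\<And>x. x < N \<Longrightarrow> cyc b x c \<Longrightarrow> {a, x} \<notin> ?E"
      using farthest_vertex[of "Suc a mod N" N a c "\<lambda>x. {a, x} \<in> ?E"] by blast
    have "{b, c} \<in> ?E"
    proof (rule ccontr)
      assume notin: "{b, c} \<notin> ?E"
      then have "{b, c} \<in> diagonals N - T"
        using pair_mem[of b c N] b(1) less(2) cyc_distinct[OF b(2)] by (simp add: diagonals_def)
      then obtain \<delta> where \<delta>: "\<delta> \<in> T" "crosses {b, c} \<delta>"
        using Tmax by blast
      then obtain x y where xy: "\<delta> = {x, y}" "cyc b x c" "cyc c y b"
        unfolding crosses_pair_iff by blast
      have E: "{x, y} \<in> ?E" using \<delta> xy by blast
      have "x < N" using sub[OF E] by auto
      have "{y, x} \<in> ?E" using E by (simp only: insert_commute)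
      then have "y \<noteq> a"
        using far[OF \<open>x < N\<close> xy(2)] by blast
      moreover have "cyc c a b"
        using b(2) by (blast intro: cyc_rotate)
      ultimately consider "cyc c y a" | "cyc a y b"
        using cyc_split[OF xy(3)] by blast
      then show False
      proof cases
        case 1
        have "cyc c a x"
          using cyc_trans[OF \<open>cyc c a b\<close>] xy(2) cyc_rotate by blast
        then have "crosses {a, c} {x, y}"
          using 1 by (blast intro: crossesI cyc_rotate)
        then show False
          using noncrossing[OF ac E] by blast
      next
        case 2
        have "cyc b x a"
          using cyc_trans[OF xy(2)] b(2) cyc_rotate by blast
        then have "crosses {a, b} {y, x}"
          using 2 by (blast intro: crossesI)
        then show False
          using noncrossing[OF b(3) \<open>{y, x} \<in> ?E\<close>] by blast
      qed
    qed
    with b show "\<exists>b<N. cyc a b c \<and> {a, b} \<in> ?E \<and> {b, c} \<in> ?E"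
      by blast
  qed
qed


section \<open>Fans and sp-diagonals\<close>

text \<open>Each step changes the vertex by one, so a path that passes from one side of the gap
  between \<open>m\<close> and \<open>m + 1\<close> to the other uses the arrow over this gap in its
  own direction.\<close>

lemma type_A_path_crosses:
  assumes Q: "type_A_quiver n Q" and path: "(x, y) \<in> Q\<^sup>*"
  shows "x \<le> m \<Longrightarrow> m < y \<Longrightarrow> (m, Suc m) \<in> Q" and "m < x \<Longrightarrow> y \<le> m \<Longrightarrow> (Suc m, m) \<in> Q"
proof -
  have step_cases: "z = Suc y \<or> y = Suc z" if "(y, z) \<in> Q" for y z
    using Q that unfolding type_A_quiver_def by blast
  have "(x \<le> m \<longrightarrow> m < y \<longrightarrow> (m, Suc m) \<in> Q) \<and> (m < x \<longrightarrow> y \<le> m \<longrightarrow> (Suc m, m) \<in> Q)"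
    using path
  proof (induction rule: rtrancl_induct)
    case (step y z)
    from step_cases[OF step(2)] show ?case
    proof
      assume "z = Suc y"
      then have "m < z \<Longrightarrow> m < y \<or> m = y" "z \<le> m \<Longrightarrow> y \<le> m" by linarith+
      then show ?case using step(2,3) \<open>z = Suc y\<close> by blast
    next
      assume "y = Suc z"
      then have "m < z \<Longrightarrow> m < y" "z \<le> m \<Longrightarrow> y \<le> m \<or> z = m" by linarith+
      then show ?case using step(2,3) \<open>y = Suc z\<close> by blast
    qed
  qed simp
  then show "x \<le> m \<Longrightarrow> m < y \<Longrightarrow> (m, Suc m) \<in> Q" "m < x \<Longrightarrow> y \<le> m \<Longrightarrow> (Suc m, m) \<in> Q"
    by blast+
qed

lemma type_A_not_both: "type_A_quiver n Q \<Longrightarrow> (m, Suc m) \<in> Q \<Longrightarrow> (Suc m, m) \<notin> Q"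
  unfolding type_A_quiver_def by fastforce

text \<open>Paths in both directions would use both orientations of the edge that follows the
  smaller end.\<close>

lemma type_A_antisym:
  assumes "type_A_quiver n Q" "(x, y) \<in> Q\<^sup>*" "(y, x) \<in> Q\<^sup>*"
  shows "x = y"
proof (rule ccontr)
  assume "x \<noteq> y"
  then consider "x < y" | "y < x" by linarith
  then show False
    using type_A_path_crosses[OF assms(1)] type_A_not_both[OF assms(1)] assms(2,3)
    by cases (metis order_refl)+
qed

lemma cyc_total: "a \<noteq> b \<Longrightarrow> b \<noteq> c \<Longrightarrow> a \<noteq> c \<Longrightarrow> cyc a b c \<or> cyc a c b"
  unfolding cyc_def by arith

section \<open>Spokes at a vertex and the peak of their fan\<close>

context labelled_triangulation
begin

lemma label_exists:
  assumes "{v, w} \<in> edges n \<tau>" "{v, w} \<notin> boundary_edges (n + 3)"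
  obtains i where "i \<in> {1..n}" "\<tau> i = {v, w}"
  using assms by auto

text \<open>All spokes at \<open>v\<close> lie below the first one after \<open>v\<close>, which is therefore the peak of the fan.\<close>

lemma spoke_path:
  assumes i: "i \<in> {1..n}" "\<tau> i = {v, w1}"
    and first: "\<And>x. x < n + 3 \<Longrightarrow> cyc v x w1 \<Longrightarrow> {v, x} \<notin> \<tau> ` {1..n}"
  shows "j \<in> {1..n} \<Longrightarrow> \<tau> j = {v, w} \<Longrightarrow> (j, i) \<in> (triangulation_quiver n \<tau>)\<^sup>*"
proof (induction "card {x. x < n + 3 \<and> cyc v x w}" arbitrary: w j rule: less_induct)
  case less
  have E: "{v, w1} \<in> edges n \<tau>" "{v, w} \<in> edges n \<tau>"
    using i less.prems by (metis UnI1 imageI)+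
  have less_N: "v < n + 3" "w1 < n + 3" "w < n + 3" "v \<noteq> w1" "v \<noteq> w"
    using edgeD[OF E(1)] edgeD[OF E(2)] by auto
  show ?case
  proof (cases "w = w1")
    case True
    then have "j = i"
      using inj_onD[OF inj, of j i] i less.prems by simp
    then show ?thesis by simp
  next
    case False
    have "\<not> cyc v w w1"
      using first[OF less_N(3)] less.prems by (metis imageI)
    then have vw1w: "cyc v w1 w"
      using cyc_total[of v w1 w] less_N False by blast
    then obtain b where b: "b < n + 3" "cyc v b w" "{v, b} \<in> edges n \<tau>" "{b, w} \<in> edges n \<tau>"
      using apex[OF E(2) less_N(2)] by blast
    \<comment> \<open>The triangle over \<open>{v, w}\<close> gives an arrow to the earlier spoke
      \<open>{v, b}\<close>, which needs a label. If \<open>b\<close> were the successor of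
      \<open>v\<close>, then \<open>{v, w1}\<close> would cross \<open>{b, w}\<close>; the
      predecessor of \<open>v\<close> does not come before \<open>w\<close>.\<close>
    have "{v, b} \<notin> boundary_edges (n + 3)"
    proof
      assume "{v, b} \<in> boundary_edges (n + 3)"
      then consider "b = Suc v mod (n + 3)" | "v = Suc b mod (n + 3)"
        using boundary_edge_cases by blast
      then show False
      proof cases
        case 1
        have "w1 \<noteq> b"
          using label_not_boundary[OF i(1)] i(2) 1 boundary_edge_mem[OF less_N(1)] by auto
        moreover have "\<not> cyc v w1 b"
          using boundary_not_between[OF less_N(1,2)] 1 by simp
        ultimately have "cyc b w1 w"
          using cyc_split[OF vw1w b(2)] by blast
        moreover have "{w1, v} \<in> edges n \<tau>"
          using E(1) by (simp only: insert_commute)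
        moreover have "cyc w v b"
          using b(2) by (blast intro: cyc_rotate)
        ultimately show False
          using not_cross[OF b(4)] by blast
      next
        case 2
        then show False
          using boundary_not_between[OF b(1) less_N(3)] b(2) cyc_rotate by blast
      qed
    qed
    then obtain j' where j': "j' \<in> {1..n}" "\<tau> j' = {v, b}"
      using label_exists b(3) by blast
    have "cyc w v b"
      using b(2) by (blast intro: cyc_rotate)
    moreover have "{w, v} \<in> edges n \<tau>"
      using E(2) by (simp only: insert_commute)
    ultimately have "arrow {w, v} {v, b}"
      using arrowI[of w v b] b by blast
    then have "arrow (\<tau> j) (\<tau> j')"
      unfolding less.prems j' by (simp only: insert_commute)
    then have "(j, j') \<in> triangulation_quiver n \<tau>"
      using triangulation_quiver_iff less.prems(1) j'(1) by blast
    moreover have "{x. x < n + 3 \<and> cyc v x b} \<subseteq> {x. x < n + 3 \<and> cyc v x w}"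
      using cyc_trans[OF _ b(2)] by blast
    then have "{x. x < n + 3 \<and> cyc v x b} \<subset> {x. x < n + 3 \<and> cyc v x w}"
      using b(1,2) cyc_distinct by blast
    then have "card {x. x < n + 3 \<and> cyc v x b} < card {x. x < n + 3 \<and> cyc v x w}"
      by (intro psubset_card_mono) auto
    then have "(j', i) \<in> (triangulation_quiver n \<tau>)\<^sup>*"
      by (rule less.hyps[OF _ j'])
    ultimately show ?thesis
      by (rule converse_rtrancl_into_rtrancl)
  qed
qed

lemma first_spoke_peak:
  assumes "type_A_quiver n (triangulation_quiver n \<tau>)" "v < n + 3" "{v, x0} \<in> \<tau> ` {1..n}"
  obtains w1 where "{v, w1} \<in> \<tau> ` {1..n}"
    "is_peak n \<tau> (quiver_poset n (triangulation_quiver n \<tau>)) {\<delta> \<in> \<tau> ` {1..n}. v \<in> \<delta>} {v, w1}"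
    "\<And>x. {v, x} \<in> \<tau> ` {1..n} \<Longrightarrow> \<not> cyc v x w1"
proof -
  have spoke_less: "x < n + 3 \<and> x \<noteq> v" if "{v, x} \<in> \<tau> ` {1..n}" for x
    using edgeD[of v x] that by blast
  have "x0 < n + 3" "x0 \<noteq> v"
    using spoke_less[OF assms(3)] by blast+
  then obtain w1 where "w1 < n + 3" "w1 \<noteq> v" and w1: "{v, w1} \<in> \<tau> ` {1..n}"
    and first: "\<And>x. x < n + 3 \<Longrightarrow> cyc v x w1 \<Longrightarrow> {v, x} \<notin> \<tau> ` {1..n}"
    using assms(3) by (rule nearest_vertex[where P = "\<lambda>x. {v, x} \<in> \<tau> ` {1..n}"]) (rule that)
  then obtain i where i: "i \<in> {1..n}" "\<tau> i = {v, w1}"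
    by (metis imageE)
  \<comment> \<open>Every spoke lies below \<open>i\<close>, so antisymmetry identifies a spoke
    above \<open>i\<close> with \<open>i\<close>.\<close>
  have "j = i" if "j \<in> {1..n}" "v \<in> \<tau> j" "(i, j) \<in> quiver_poset n (triangulation_quiver n \<tau>)" for j
  proof -
    have "\<tau> j \<in> edges n \<tau>" using that(1) by blast
    from subsetD[OF pairs this] obtain p q where "\<tau> j = {p, q}"
      by blast
    with that(2) have "\<exists>w. \<tau> j = {v, w}"
      by (metis insert_commute insertE singletonD)
    then obtain w where "\<tau> j = {v, w}" by blast
    then have "(j, i) \<in> (triangulation_quiver n \<tau>)\<^sup>*"
      using spoke_path[OF i first that(1)] by blast
    moreover have "(i, j) \<in> (triangulation_quiver n \<tau>)\<^sup>*"
      using that(3) by (simp add: quiver_poset_def)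
    ultimately show "j = i"
      by (rule type_A_antisym[OF assms(1)])
  qed
  then have "is_peak n \<tau> (quiver_poset n (triangulation_quiver n \<tau>)) {\<delta> \<in> \<tau> ` {1..n}. v \<in> \<delta>} {v, w1}"
    unfolding is_peak_def using i by (intro bexI[of _ i]) auto
  then show thesis
    using that[OF w1] first spoke_less by blast
qed

lemma sp_or_edge:
  assumes typeA: "type_A_quiver n (triangulation_quiver n \<tau>)" and v: "v < n + 3"
    and deg: "2 \<le> card {\<delta> \<in> \<tau> ` {1..n}. v \<in> \<delta>}"
    and vw: "{v, w} \<in> edges n \<tau>" and w: "w \<noteq> Suc v mod (n + 3)"
    and notin: "{Suc v mod (n + 3), w} \<notin> edges n \<tau>"
  shows "{Suc v mod (n + 3), w} \<in> sp_diagonals n \<tau> (quiver_poset n (triangulation_quiver n \<tau>))"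
proof -
  define s where "s = Suc v mod (n + 3)"
  define F where "F = {\<delta> \<in> \<tau> ` {1..n}. v \<in> \<delta>}"
  have less: "s < n + 3" "w < n + 3" "v \<noteq> w"
    using edgeD[OF vw] by (simp_all add: s_def)
  have between: "\<not> cyc v z s" if "z < n + 3" for z
    using boundary_not_between[OF v that] by (simp add: s_def)
  have "s \<noteq> v"
    using edgeD(3)[OF next_edge[OF v]] by (simp add: s_def)
  then have vsw: "cyc v s w"
    using cyc_total[of v s w] less w between[of w] by (auto simp: s_def)
  have "{s, w} \<in> diagonals (n + 3) - \<tau> ` {1..n}"
    using notin pair_mem[of s w "n + 3"] less w by (simp add: diagonals_def s_def)
  moreover have "\<exists>\<Sigma> \<pi>. is_fan (\<tau> ` {1..n}) \<Sigma> \<and> \<delta> \<in> \<Sigma> \<and>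
      is_peak n \<tau> (quiver_poset n (triangulation_quiver n \<tau>)) \<Sigma> \<pi> \<and> crosses {s, w} \<pi>"
    if \<delta>: "\<delta> \<in> \<tau> ` {1..n}" "crosses {s, w} \<delta>" for \<delta>
  proof -
    obtain x y where xy: "\<delta> = {x, y}" "cyc s x w" "cyc w y s"
      using \<delta>(2) unfolding crosses_pair_iff by blast
    have E: "{x, y} \<in> edges n \<tau>" using \<delta>(1) xy(1) by blast
    have vxw: "cyc v x w"
      using cyc_trans[of w v s x] vsw xy(2) cyc_rotate by blast
    have "cyc w v s"
      using vsw cyc_rotate by blast
    \<comment> \<open>The arc from \<open>w\<close> to \<open>s\<close> consists of the part before
      \<open>v\<close>, excluded because \<open>\<delta>\<close> would cross \<open>{v, w}\<close>,
      then \<open>v\<close>, and nothing between \<open>v\<close> and its successor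
      \<open>s\<close>.\<close>
    then have "y = v"
      using cyc_split[OF xy(3)] not_cross[OF vw E vxw] between[OF edgeD(2)[OF E]] cyc_rotate by blast
    then have vx: "{v, x} \<in> \<tau> ` {1..n}"
      using \<delta>(1) xy(1) by (simp only: insert_commute)
    then obtain w1 where w1: "{v, w1} \<in> \<tau> ` {1..n}"
      and peak: "is_peak n \<tau> (quiver_poset n (triangulation_quiver n \<tau>)) F {v, w1}"
      and first: "\<And>x. {v, x} \<in> \<tau> ` {1..n} \<Longrightarrow> \<not> cyc v x w1"
      using first_spoke_peak[OF typeA v vx] unfolding F_def by blast
    have w1_less: "w1 < n + 3" "v \<noteq> w1"
      using edgeD[of v w1] w1 by blast+
    \<comment> \<open>The first spoke comes no later than \<open>{v, x}\<close>, hence before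
      \<open>w\<close>. Not being a boundary edge it ends after \<open>s\<close>, so
      \<open>{s, w}\<close> crosses it as well.\<close>
    have "cyc v w1 w"
      using cyc_total[of v x w1] cyc_distinct[OF vxw] first[OF vx] w1_less vxw cyc_trans[OF _ vxw] by blast
    moreover have "w1 \<noteq> s"
      using w1 interior boundary_edge_mem[OF v] unfolding s_def by blast
    ultimately have "cyc s w1 w"
      using cyc_split[OF _ vsw] between[OF w1_less(1)] by blast
    then have "crosses {s, w} {w1, v}"
      using \<open>cyc w v s\<close> by (rule crossesI)
    then have "crosses {s, w} {v, w1}"
      by (simp only: insert_commute)
    moreover have "is_fan (\<tau> ` {1..n}) F"
      unfolding is_fan_def F_def using deg by blast
    moreover have "\<delta> \<in> F"
      using \<delta>(1) xy(1) \<open>y = v\<close> by (simp add: F_def)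
    ultimately show ?thesis
      using peak by blast
  qed
  ultimately show ?thesis
    unfolding sp_diagonals_def s_def by blast
qed

end


section \<open>Generation by the sp-diagonals\<close>

lemma card_less_two_cases:
  assumes "finite S"
  obtains "2 \<le> card S" | "S = {}" | x where "S = {x}"
proof -
  consider "card S = 0" | "card S = 1" | "2 \<le> card S" by linarith
  then show thesis
  proof cases
    case 1
    then show thesis using that(2) assms by simp
  next
    case 2
    then show thesis using that(3) by (rule card_1_singletonE)
  qed (rule that(1))
qed

section \<open>Generated subalgebras\<close>

lemma scalar_one: "scalar 1 = 1"
  by (simp add: scalar_def One_fract_def)

lemma scalar_minus_one: "scalar (- 1) = - 1"
  by (simp add: scalar_def One_fract_def single_uminus)

lemma subalgebra_one: "is_subalgebra A \<Longrightarrow> 1 \<in> A"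
  unfolding is_subalgebra_def scalar_one[symmetric] by blast

lemma subalgebra_mult: "is_subalgebra A \<Longrightarrow> a \<in> A \<Longrightarrow> b \<in> A \<Longrightarrow> a * b \<in> A"
  unfolding is_subalgebra_def by blast

lemma subalgebra_diff:
  assumes "is_subalgebra A" "a \<in> A" "b \<in> A"
  shows "a - b \<in> A"
proof -
  have "scalar (- 1) * b \<in> A"
    using assms(1,3) unfolding is_subalgebra_def by blast
  then have "a + scalar (- 1) * b \<in> A"
    using assms(1,2) unfolding is_subalgebra_def by blast
  then show ?thesis
    by (simp add: scalar_minus_one)
qed

lemma is_subalgebra_generated: "is_subalgebra (generated_subalgebra S)"
  unfolding generated_subalgebra_def
proof (rule hull_in)
  fix F assume F: "\<forall>A\<in>F. is_subalgebra A"
  show "is_subalgebra (\<Inter>F)"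
    unfolding is_subalgebra_def
  proof (intro conjI ballI)
    show "range scalar \<subseteq> \<Inter>F"
      using F unfolding is_subalgebra_def by (intro Inter_greatest) simp
  next
    fix a b assume "a \<in> \<Inter>F" "b \<in> \<Inter>F"
    then have "a \<in> A \<and> b \<in> A \<and> is_subalgebra A" if "A \<in> F" for A
      using that F by simp
    then show "a + b \<in> \<Inter>F" "a * b \<in> \<Inter>F"
      unfolding is_subalgebra_def by simp_all
  qed
qed

lemma generated_subalgebra_mono_iff: "generated_subalgebra S \<subseteq> generated_subalgebra S' \<longleftrightarrow> S \<subseteq> generated_subalgebra S'"
  unfolding generated_subalgebra_def
  using hull_minimal[of S "is_subalgebra hull S'" is_subalgebra] hull_subset[of S is_subalgebra]
    is_subalgebra_generated[of S'] unfolding generated_subalgebra_def by blast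

lemma generated_subalgebra_incl: "S \<subseteq> generated_subalgebra S"
  unfolding generated_subalgebra_def by (rule hull_subset)

context labelled_triangulation
begin

text \<open>
  If at least two members of the triangulation end at \<open>k\<close>, the diagonal cutting off \<open>k\<close> crosses
  a whole fan. If \<open>{v, k}\<close> is the only one, the Ptolemy relation for \<open>k - 1\<close>, \<open>k + 1\<close> and the
  boundary edge from \<open>v\<close> to its successor expresses its variable through sp-diagonals.
\<close>

lemma ear_generated:
  assumes X: "ptolemy_function n \<tau> X" and A: "is_subalgebra A"
    and edge: "\<And>\<gamma>. \<gamma> \<in> edges n \<tau> \<Longrightarrow> X \<gamma> \<in> A"
    and sp: "\<And>\<gamma>. \<gamma> \<in> sp_diagonals n \<tau> (quiver_poset n (triangulation_quiver n \<tau>)) \<Longrightarrow> X \<gamma> \<in> A"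
    and typeA: "type_A_quiver n (triangulation_quiver n \<tau>)" and "2 \<le> n"
    and p: "p + 2 < n + 3"
  shows "X {p, p + 2} \<in> A"
proof -
  define k s where "k = Suc p" and "s = Suc k"
  have less: "p < n + 3" "k < n + 3" "s < n + 3" and s: "s = Suc k mod (n + 3)" and k: "k = Suc p mod (n + 3)"
    using p by (simp_all add: k_def s_def)
  have pk: "{p, k} \<in> edges n \<tau>" and ks: "{k, s} \<in> edges n \<tau>"
    using next_edge[OF less(1)] next_edge[OF less(2)] by (simp_all only: s k[symmetric])
  have kp: "{k, p} \<in> edges n \<tau>" and sk: "{s, k} \<in> edges n \<tau>"
    using pk ks by (simp_all only: insert_commute)
  have fan: "X {Suc v mod (n + 3), w} \<in> A"
    if "2 \<le> card {\<delta> \<in> \<tau> ` {1..n}. v \<in> \<delta>}" "{v, w} \<in> edges n \<tau>" "w \<noteq> Suc v mod (n + 3)" for v w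
    using sp_or_edge[OF typeA edgeD(1)[OF that(2)] that] edge sp by blast
  \<comment> \<open>The only edges at \<open>k\<close> without a label are the two boundary
    edges.\<close>
  have spoke: "b = p \<or> b = s" if kb: "{k, b} \<in> edges n \<tau>" and "{k, b} \<notin> \<tau> ` {1..n}" for b
  proof -
    have "{k, b} \<in> boundary_edges (n + 3)" using that by blast
    then have "b = s \<or> k = Suc b mod (n + 3)"
      using boundary_edge_cases s by blast
    moreover have "b = p" if "k = Suc b mod (n + 3)"
      using that edgeD(2)[OF kb] by (cases "Suc b = n + 3") (simp_all add: k_def)
    ultimately show ?thesis by blast
  qed
  have finite_spokes: "finite {\<delta> \<in> \<tau> ` {1..n}. v \<in> \<delta>}" for v by simp
  have "X {p, s} \<in> A"
    using finite_spokes[of k]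
  proof (cases rule: card_less_two_cases)
    case 1
    have "p \<noteq> s" by (simp add: k_def s_def)
    then have "X {s, p} \<in> A"
      using fan[OF 1 kp] unfolding s[symmetric] by blast
    then show ?thesis by (simp only: insert_commute)
  next
    case 2
    \<comment> \<open>Without spokes at \<open>k\<close>, the triangle over \<open>{s, k}\<close>
      must have apex \<open>p\<close>, so \<open>{p, s}\<close> is already an edge.\<close>
    have "cyc s p k" by (simp add: cyc_def s_def k_def)
    then obtain b where b: "cyc s b k" "{s, b} \<in> edges n \<tau>" "{b, k} \<in> edges n \<tau>"
      using apex[OF sk less(1)] by blast
    then have "{k, b} \<in> edges n \<tau>" by (simp only: insert_commute)
    moreover have "{k, b} \<notin> \<tau> ` {1..n}" using 2 by blast
    ultimately have "b = p"
      using spoke cyc_distinct[OF b(1)] by blast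
    then have "{p, s} \<in> edges n \<tau>"
      using b(2) by (simp only: insert_commute)
    then show ?thesis by (rule edge)
  next
    case (3 \<delta>)
    then have "\<delta> \<in> edges n \<tau>" "k \<in> \<delta>" "\<delta> \<in> \<tau> ` {1..n}" by blast+
    from subsetD[OF pairs this(1)] obtain i j where "\<delta> = {i, j}" by blast
    then obtain v where \<delta>: "\<delta> = {k, v}"
      using \<open>k \<in> \<delta>\<close> by (metis insertE insert_commute singletonD)
    have kv: "{k, v} \<in> edges n \<tau>" "{k, v} \<in> \<tau> ` {1..n}"
      using \<open>\<delta> \<in> edges n \<tau>\<close> \<open>\<delta> \<in> \<tau> ` {1..n}\<close> \<delta> by blast+
    then have vk: "{v, k} \<in> edges n \<tau>" by (simp only: insert_commute)
    have v: "v < n + 3" "v \<noteq> k"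
      using edgeD[OF kv(1)] by simp_all
    have kv_interior: "{k, v} \<notin> boundary_edges (n + 3)"
      using kv(2) interior by blast
    have unique: "b = v" if "{k, b} \<in> \<tau> ` {1..n}" for b
    proof -
      have "{k, b} \<in> {\<delta> \<in> \<tau> ` {1..n}. k \<in> \<delta>}" using that by blast
      then have "{k, b} = {k, v}" unfolding 3 \<delta> by (rule singletonD)
      then show ?thesis by (auto simp: doubleton_eq_iff)
    qed
    have "v \<noteq> s"
      using kv_interior boundary_edge_mem[OF less(2)] s by metis
    have "v \<noteq> p"
      using kv_interior boundary_edge_mem[OF less(1)] k by (metis insert_commute)
    have ksv: "cyc k s v" and vpk: "cyc v p k"
      using v \<open>v \<noteq> s\<close> \<open>v \<noteq> p\<close> by (auto simp: cyc_def k_def s_def)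
    \<comment> \<open>The two triangles at the only spoke \<open>{k, v}\<close> have their third
      vertices joined to \<open>k\<close>, so these are \<open>s\<close> and \<open>p\<close>; hence
      \<open>{v, s}\<close> and \<open>{v, p}\<close> are edges.\<close>
    have "{v, s} \<in> edges n \<tau>"
    proof -
      obtain b where b: "cyc k b v" "{k, b} \<in> edges n \<tau>" "{b, v} \<in> edges n \<tau>"
        using apex[OF kv(1) less(3) ksv] by blast
      have "b \<noteq> v" using cyc_distinct[OF b(1)] by blast
      moreover have "b \<noteq> p" using b(1) vpk cyc_rotate cyc_asym by blast
      ultimately have "b = s" using spoke[OF b(2)] unique by blast
      then show ?thesis using b(3) by (simp only: insert_commute)
    qed
    have "{v, p} \<in> edges n \<tau>"
    proof -
      obtain b where b: "cyc v b k" "{v, b} \<in> edges n \<tau>" "{b, k} \<in> edges n \<tau>"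
        using apex[OF vk less(1) vpk] by blast
      have kb: "{k, b} \<in> edges n \<tau>" using b(3) by (simp only: insert_commute)
      have "b \<noteq> v" using cyc_distinct[OF b(1)] by blast
      moreover have "b \<noteq> s" using b(1) ksv cyc_rotate cyc_asym by blast
      ultimately have "b = p" using spoke[OF kb] unique by blast
      then show ?thesis using b(2) by simp
    qed
    define t where "t = Suc v mod (n + 3)"
    have t: "t < n + 3" "t \<noteq> v" "{v, t} \<in> edges n \<tau>" "X {v, t} = 1"
      using next_edge[OF v(1)] edgeD[OF next_edge[OF v(1)]] X boundary_edge_mem[OF v(1)]
      by (simp_all add: t_def ptolemy_function_def)
    have "t \<noteq> s"
      using v less(2) by (auto simp: t_def s_def k_def mod_Suc split: if_splits)
    \<comment> \<open>If both were boundary edges, the polygon would be the square \<open>p\<close>,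
      \<open>k\<close>, \<open>s\<close>, \<open>v\<close>, contrary to \<open>2 \<le> n\<close>. So
      one of them is a second spoke at \<open>v\<close>, which thus carries a fan.\<close>
    have "\<not> ({v, p} \<in> boundary_edges (n + 3) \<and> {v, s} \<in> boundary_edges (n + 3))"
    proof
      assume "{v, p} \<in> boundary_edges (n + 3) \<and> {v, s} \<in> boundary_edges (n + 3)"
      then have "p = t \<or> v = k" "v = Suc s mod (n + 3) \<or> s = t"
        using boundary_edge_cases[of v p] boundary_edge_cases[of v s] k t_def by blast+
      then have "p = Suc v mod (n + 3)" "v = Suc s mod (n + 3)"
        using v \<open>t \<noteq> s\<close> by (simp_all add: t_def)
      then show False
        using p \<open>2 \<le> n\<close> by (auto simp: s_def k_def mod_Suc split: if_splits)
    qed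
    then obtain w where w: "{v, w} \<in> \<tau> ` {1..n}" "w \<noteq> k"
      using \<open>{v, s} \<in> edges n \<tau>\<close> \<open>{v, p} \<in> edges n \<tau>\<close> k_def s_def by (metis UnE n_not_Suc_n)
    have "{{v, w}, {v, k}} \<subseteq> {\<delta> \<in> \<tau> ` {1..n}. v \<in> \<delta>}"
      using w(1) kv(2) by (simp add: insert_commute)
    then have "card {{v, w}, {v, k}} \<le> card {\<delta> \<in> \<tau> ` {1..n}. v \<in> \<delta>}"
      by (rule card_mono[OF finite_spokes])
    moreover have "{v, w} \<noteq> {v, k}"
      using w(2) by (auto simp: doubleton_eq_iff)
    ultimately have deg: "2 \<le> card {\<delta> \<in> \<tau> ` {1..n}. v \<in> \<delta>}" by simp
    have ts: "X {t, s} \<in> A"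
      using fan[OF deg \<open>{v, s} \<in> edges n \<tau>\<close>] \<open>t \<noteq> s\<close> by (simp add: t_def)
    show ?thesis
    proof (cases "p = t")
      \<comment> \<open>The quadrilateral degenerates: the sp-diagonal or edge \<open>{t, s}\<close>
        is the wanted one.\<close>
      case True
      then show ?thesis using ts by simp
    next
      case False
      then have tp: "X {t, p} \<in> A"
        using fan[OF deg \<open>{v, p} \<in> edges n \<tau>\<close>] by (simp add: t_def)
      have "cyc v t p"
        using cyc_total[of v t p] t(2) False \<open>v \<noteq> p\<close> boundary_not_between[OF v(1) less(1)]
        by (auto simp: t_def)
      moreover have "cyc p s v"
        using \<open>v \<noteq> s\<close> \<open>v \<noteq> p\<close> v(2) by (auto simp: cyc_def k_def s_def)
      \<comment> \<open>In the order \<open>v\<close>, \<open>t\<close>, \<open>p\<close>,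
        \<open>s\<close> the coefficient of \<open>X {p, s}\<close> is the boundary value
        \<open>X {v, t} = 1\<close>.\<close>
      ultimately have "X {v, p} * X {t, s} = X {v, t} * X {p, s} + X {t, p} * X {v, s}"
        by (intro ptolemy_cyc[OF X] v(1) t(1) less)
      then have "X {p, s} = X {v, p} * X {t, s} - X {t, p} * X {v, s}"
        using t(4) by simp
      also have "\<dots> \<in> A"
        using ts tp edge \<open>{v, p} \<in> edges n \<tau>\<close> \<open>{v, s} \<in> edges n \<tau>\<close>
        by (intro subalgebra_diff[OF A] subalgebra_mult[OF A]) blast+
      finally show ?thesis .
    qed
  qed
  then show ?thesis by (simp add: s_def k_def)
qed

text \<open>The three-term (continuant) recurrence of a Conway-Coxeter frieze: in the quadrilateral
  \<open>a\<close>, \<open>m\<close>, \<open>m + 1\<close>, \<open>m + 2\<close> the last two short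
  sides are boundary edges of value 1. As \<open>a < b\<close> throughout, the recurrence never
  passes vertex 0, and ears \<open>{p, p + 2}\<close> without wrap-around suffice.\<close>

lemma all_generated:
  assumes X: "ptolemy_function n \<tau> X" and A: "is_subalgebra A"
    and edge: "\<And>\<gamma>. \<gamma> \<in> edges n \<tau> \<Longrightarrow> X \<gamma> \<in> A"
    and ear: "\<And>p. p + 2 < n + 3 \<Longrightarrow> X {p, p + 2} \<in> A"
  shows "a < b \<Longrightarrow> b < n + 3 \<Longrightarrow> X {a, b} \<in> A"
proof (induction b rule: less_induct)
  case (less b)
  have boundary: "X {i, Suc i} = 1" if "Suc i < n + 3" for i
    using X boundary_edge_mem[of i "n + 3"] that by (simp add: ptolemy_function_def)
  consider "b = Suc a" | "b = a + 2" | m where "b = Suc (Suc m)" "a < m"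
    using less.prems(1) by (metis add_2_eq_Suc' less_antisym less_imp_Suc_add not_less_eq)
  then show ?case
  proof cases
    case 1
    then show ?thesis
      using boundary less.prems subalgebra_one[OF A] by simp
  next
    case 2
    then show ?thesis using ear less.prems by simp
  next
    case 3
    have "X {a, Suc m} * X {m, b} = X {a, m} * X {Suc m, b} + X {m, Suc m} * X {a, b}"
      using X 3 less.prems unfolding ptolemy_function_def by simp
    then have "X {a, b} = X {a, Suc m} * X {m, m + 2} - X {a, m}"
      using boundary[of m] boundary[of "Suc m"] less.prems 3 by (simp add: algebra_simps)
    also have "\<dots> \<in> A"
      using less.IH[of m] less.IH[of "Suc m"] ear[of m] 3 less.prems
      by (intro subalgebra_diff[OF A] subalgebra_mult[OF A]) simp_all
    finally show ?thesis .
  qed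
qed

end

section \<open>Equality of the two algebras\<close>

lemma represented_initial:
  assumes "labelled_triangulation n \<tau>" "triangulation_quiver n \<tau> = Q"
  shows "represents n \<tau> (quiver_matrix Q, var) \<tau>"
  using assms by (simp add: represents_def ptolemy_function_def)

lemma diagonal_variable_eq:
  assumes L: "labelled_triangulation n \<tau>" and X: "ptolemy_function n \<tau> X"
    and \<gamma>: "\<gamma> \<in> diagonals (n + 3)"
  shows "diagonal_variable n \<tau> \<gamma> = X \<gamma>"
    and "X \<gamma> \<in> cluster_variables n (triangulation_quiver n \<tau>)"
proof -
  let ?Q = "triangulation_quiver n \<tau>"
  obtain p q where pq: "\<gamma> = {p, q}" "p < q" "q < n + 3" "\<gamma> \<notin> boundary_edges (n + 3)"
    using \<gamma> unfolding diagonals_def by blast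
  then have "p < n + 3" "p \<noteq> q" by simp_all
  from diagonal_reached[OF represented_initial[OF L refl] seeds.initial this(1) pq(3) this(2)] pq(1,4)
  obtain B u \<tau>' i where rep: "represents n \<tau> (B, u) \<tau>'" and seed: "(B, u) \<in> seeds n ?Q"
    and i: "i \<in> {1..n}" "\<tau>' i = \<gamma>"
    by auto
  \<comment> \<open>The right-hand side does not depend on \<open>Y\<close>: this makes the definite
    description unique and identifies its value as a cluster variable.\<close>
  have val: "Y \<gamma> = u i" if "ptolemy_function n \<tau> Y" for Y
    using rep that i by (simp add: represents_def)
  show "diagonal_variable n \<tau> \<gamma> = X \<gamma>"
    unfolding diagonal_variable_def
  proof (rule the_equality)
    show "\<exists>Y. ptolemy_function n \<tau> Y \<and> Y \<gamma> = X \<gamma>"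
      using X by blast
  next
    fix y assume "\<exists>Y. ptolemy_function n \<tau> Y \<and> Y \<gamma> = y"
    then obtain Y where "ptolemy_function n \<tau> Y" "Y \<gamma> = y" by blast
    then show "y = X \<gamma>"
      using val[of Y] val[OF X] by simp
  qed
  show "X \<gamma> \<in> cluster_variables n ?Q"
    unfolding cluster_variables_def val[OF X] using seed i(1) by blast
qed

theorem theorem5p2:
  fixes n :: nat and Q :: "nat rel" and T :: "nat set set" and \<tau> :: "nat \<Rightarrow> nat set"
  assumes "2 \<le> n"
    and "type_A_quiver n Q"
    and "is_triangulation (n + 3) T"
    and "bij_betw \<tau> {1..n} T"
    and "triangulation_quiver n \<tau> = Q"
  shows "poset_subalgebra n \<tau> (quiver_poset n Q) = cluster_algebra n Q"
proof -
  have image: "\<tau> ` {1..n} = T" and inj: "inj_on \<tau> {1..n}"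
    using assms(4) by (simp_all add: bij_betw_def)
  have interior: "T \<inter> boundary_edges (n + 3) = {}"
    using assms(3) unfolding is_triangulation_def diagonals_def by blast
  have "triangulated (n + 3) (edges n \<tau>)"
    unfolding image by (rule triangulation_triangulated[OF assms(3)]) simp
  then have L: "labelled_triangulation n \<tau>"
    using inj interior unfolding image[symmetric]
    by (intro labelled_triangulation.intro labelled_triangulation_axioms.intro)
  interpret labelled_triangulation n \<tau> by (rule L)
  obtain X where X: "ptolemy_function n \<tau> X"
    using ptolemy_exists by blast
  let ?A = "poset_subalgebra n \<tau> (quiver_poset n Q)"
  have A: "is_subalgebra ?A"
    unfolding poset_subalgebra_def by (rule is_subalgebra_generated)
  have incl: "var ` {1..n} \<union> diagonal_variable n \<tau> ` sp_diagonals n \<tau> (quiver_poset n Q) \<subseteq> ?A"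
    unfolding poset_subalgebra_def by (rule generated_subalgebra_incl)
  have edge: "X \<gamma> \<in> ?A" if "\<gamma> \<in> edges n \<tau>" for \<gamma>
    using that
  proof
    assume "\<gamma> \<in> \<tau> ` {1..n}"
    then obtain i where "i \<in> {1..n}" "\<gamma> = \<tau> i" by blast
    then have "X \<gamma> = var i" "var i \<in> var ` {1..n}"
      using X by (simp_all add: ptolemy_function_def)
    then show ?thesis using incl by auto
  next
    assume "\<gamma> \<in> boundary_edges (n + 3)"
    then show ?thesis
      using X subalgebra_one[OF A] by (simp add: ptolemy_function_def)
  qed
  have sp: "X \<gamma> \<in> ?A" if "\<gamma> \<in> sp_diagonals n \<tau> (quiver_poset n Q)" for \<gamma>
  proof -
    have "\<gamma> \<in> diagonals (n + 3)"
      using that unfolding sp_diagonals_def by blast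
    then show ?thesis
      using diagonal_variable_eq(1)[OF L X] that incl by (metis UnI2 imageI subsetD)
  qed
  \<comment> \<open>Stated for an arbitrary labelled triangulation, because the cluster of any seed
    consists of values of \<open>X\<close> on the diagonals of one.\<close>
  have all: "X \<gamma> \<in> ?A" if \<gamma>: "\<gamma> \<in> edges n \<tau>'" "labelled_triangulation n \<tau>'" for \<gamma> \<tau>'
  proof -
    obtain a b where "\<gamma> = {a, b}" "a < b" "b < n + 3"
      using subsetD[OF triangulated.pairs[OF labelled_triangulation.axioms(1)[OF \<gamma>(2)]] \<gamma>(1)] by blast
    moreover have "X {p, p + 2} \<in> ?A" if "p + 2 < n + 3" for p
      using ear_generated[OF X A edge] sp assms(1,2) that unfolding assms(5) by blast
    ultimately show ?thesis
      using all_generated[OF X A edge] by blast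
  qed
  have "cluster_variables n Q \<subseteq> ?A"
  proof
    fix y assume "y \<in> cluster_variables n Q"
    then obtain B u i where y: "y = u i" "(B, u) \<in> seeds n Q" "i \<in> {1..n}"
      unfolding cluster_variables_def by blast
    obtain \<tau>' where \<tau>': "represents n \<tau> (B, u) \<tau>'"
      using seed_represented[OF represented_initial[OF L assms(5)] y(2)] by blast
    then have "y = X (\<tau>' i)" "labelled_triangulation n \<tau>'"
      using y X by (simp_all add: represents_def)
    then show "y \<in> ?A"
      using all[of "\<tau>' i" \<tau>'] y(3) by blast
  qed
  then have "cluster_algebra n Q \<subseteq> ?A"
    unfolding cluster_algebra_def poset_subalgebra_def generated_subalgebra_mono_iff .
  moreover have "var i \<in> cluster_variables n Q" if "i \<in> {1..n}" for i
    unfolding cluster_variables_def using that seeds.initial[of Q n] by blast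
  moreover have "diagonal_variable n \<tau> \<gamma> \<in> cluster_variables n Q"
    if "\<gamma> \<in> sp_diagonals n \<tau> (quiver_poset n Q)" for \<gamma>
  proof -
    have "\<gamma> \<in> diagonals (n + 3)"
      using that unfolding sp_diagonals_def by blast
    from diagonal_variable_eq[OF L X this] show ?thesis
      unfolding assms(5) by simp
  qed
  ultimately have "?A \<subseteq> cluster_algebra n Q"
    unfolding poset_subalgebra_def cluster_algebra_def generated_subalgebra_mono_iff
    using generated_subalgebra_incl[of "cluster_variables n Q"] by blast
  with \<open>cluster_algebra n Q \<subseteq> ?A\<close> show ?thesis by blast
qed

end
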